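(* Let $\mathcal{H}_A$ and $\mathcal{H}_B$ be separable complex Hilbert spaces, let $H_A$ be a symmetric operator on $\mathcal{H}_A$ and let $H_B$ be a self-adjoint operator on $\mathcal{H}_B$. Let $H_{AB}=\overline{H_A\hat{\otimes} I+I\hat{\otimes} H_B}$, an operator on $\mathcal{H}_A\hat{\otimes}\mathcal{H}_B$. Then $$\mathcal{N}_+(H_{AB})\simeq\mathcal{N}_+(H_A)\,\hat{\otimes}\,\mathcal{H}_B\quad\text{and}\quad \mathcal{N}_-(H_{AB})\simeq\mathcal{N}_-(H_A)\,\hat{\otimes}\,\mathcal{H}_B,$$ where $\simeq$ denotes isometric isomorphism of Hilbert spaces.
   Context: Operators are linear, possibly unbounded. An operator $A$ is called symmetric if it is densely defined and $A\subseteq A^*$ (it is not assumed to be closed). For a symmetric operator $A$, the deficiency spaces are $\mathcal{N}_\pm(A)=\mathcal{R}(A\pm i)^\perp=\mathcal{N}(A^*\mp i)$, where $\mathcal{R}$ denotes range and $\mathcal{N}$ denotes kernel; they are closed subspaces with the inherited inner product. $\mathcal{H}\otimes\mathcal{K}$ is the algebraic tensor product of Hilbert spaces and $\mathcal{H}\hat{\otimes}\mathcal{K}$ the Hilbert space tensor product (its completion). For operators $A$ on $\mathcal{H}$ and $B$ on $\mathcal{K}$, the operator $A\otimes B$ on $\mathcal{H}\hat{\otimes}\mathcal{K}$ has domain $\mathcal{D}(A)\otimes\mathcal{D}(B)$ and acts by $(A\otimes B)(\sum_j f_j\otimes g_j)=\sum_j Af_j\otimes Bg_j$; if $A$ and $B$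 are closable, so is $A\otimes B$, and $A\hat{\otimes}B$ denotes its closure. The sum $H_A\hat{\otimes} I+I\hat{\otimes} H_B$ has domain $\mathcal{D}(H_A\hat{\otimes} I)\cap\mathcal{D}(I\hat{\otimes} H_B)$; the overline denotes the closure of an operator. *)

theory Defs
  imports "HOL-Analysis.Analysis"
begin

section \<open>Complex Hilbert spaces\<close>

class scaleC =
  fixes scaleC :: "complex \<Rightarrow> 'a \<Rightarrow> 'a"  (infixr \<open>*\<^sub>C\<close> 75)

text \<open>
  A complex Hilbert space is a complete real inner product space carrying a compatible complex
  structure. The norm and the topology come from \<^class>\<open>real_inner\<close>: since the
  real inner product is the real part of \<open>cinner\<close>, the norm of \<open>x\<close> is the square root of
  \<open>cinner x x\<close>, and \<open>cinner\<close> is positive definite. It is antilinear in the first and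
  linear in the second argument.
\<close>

class complex_hilbert_space = real_inner + complete_space + scaleC +
  fixes cinner :: "'a \<Rightarrow> 'a \<Rightarrow> complex"
  assumes scaleC_add_right: "c *\<^sub>C (x + y) = c *\<^sub>C x + c *\<^sub>C y"
    and scaleC_add_left: "(c + d) *\<^sub>C x = c *\<^sub>C x + d *\<^sub>C x"
    and scaleC_scaleC: "c *\<^sub>C d *\<^sub>C x = (c * d) *\<^sub>C x"
    and scaleR_scaleC: "r *\<^sub>R x = complex_of_real r *\<^sub>C x"
    and cinner_commute: "cinner x y = cnj (cinner y x)"
    and cinner_add_right: "cinner x (y + z) = cinner x y + cinner x z"
    and cinner_scaleC_right: "cinner x (c *\<^sub>C y) = c * cinner x y"
    and inner_eq_Re_cinner: "inner x y = Re (cinner x y)"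

lemma scaleC_one: "1 *\<^sub>C x = (x :: 'a :: complex_hilbert_space)"
  using scaleR_scaleC[of 1 x] by simp

global_interpretation complex_vector: vector_space "scaleC :: complex \<Rightarrow> 'a \<Rightarrow> 'a :: complex_hilbert_space"
  defines csubspace = complex_vector.subspace
    and cspan = complex_vector.span
  by unfold_locales
    (simp_all add: scaleC_add_right scaleC_add_left scaleC_scaleC scaleC_one)

instantiation complex :: complex_hilbert_space
begin

definition scaleC_complex_def: "scaleC c (z :: complex) = c * z"
definition cinner_complex_def: "cinner (w :: complex) z = cnj w * z"

instance
  by standard
    (auto simp: scaleC_complex_def cinner_complex_def inner_complex_def algebra_simps scaleR_conv_of_real)

end

text \<open>The orthogonal direct sum of two Hilbert spaces, which contains the graphs of operators.\<close>

instantiation prod :: (complex_hilbert_space, complex_hilbert_space) complex_hilbert_space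
begin

definition scaleC_prod_def: "scaleC c p = (c *\<^sub>C fst p, c *\<^sub>C snd p)"
definition cinner_prod_def: "cinner p q = cinner (fst p) (fst q) + cinner (snd p) (snd q)"

instance
proof
  fix x y :: "'a \<times> 'b"
  show "cinner x y = cnj (cinner y x)"
    unfolding cinner_prod_def by (metis cinner_commute complex_cnj_add)
qed (auto simp: scaleC_prod_def cinner_prod_def scaleC_add_right scaleC_add_left scaleC_scaleC
    scaleR_scaleC[symmetric] scaleR_prod_def cinner_add_right cinner_scaleC_right inner_prod_def
    inner_eq_Re_cinner algebra_simps)

end

definition ortho_complement :: "'a :: complex_hilbert_space set \<Rightarrow> 'a set" where
  "ortho_complement S = {y. \<forall>x\<in>S. cinner x y = 0}"

definition isometrically_isomorphic ::
    "'a :: complex_hilbert_space set \<Rightarrow> 'b :: complex_hilbert_space set \<Rightarrow> bool" where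
  "isometrically_isomorphic M N \<longleftrightarrow>
     (\<exists>U. bij_betw U M N \<and>
          (\<forall>x\<in>M. \<forall>y\<in>M. U (x + y) = U x + U y) \<and>
          (\<forall>c. \<forall>x\<in>M. U (c *\<^sub>C x) = c *\<^sub>C U x) \<and>
          (\<forall>x\<in>M. norm (U x) = norm x))"


section \<open>Unbounded operators\<close>

text \<open>
  An operator is identified with its graph, so its domain and range are \<^const>\<open>Domain\<close> and
  \<^const>\<open>Range\<close>, extension of operators is inclusion, the identity is \<^const>\<open>Id\<close>, and the
  closure of a closable operator is the topological \<^const>\<open>closure\<close> of its graph.
\<close>

type_synonym ('a, 'b) operator = "('a \<times> 'b) set"

definition linear_operator ::
    "('a :: complex_hilbert_space, 'b :: complex_hilbert_space) operator \<Rightarrow> bool" where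
  "linear_operator A \<longleftrightarrow> csubspace A \<and> single_valued A"

definition densely_defined ::
    "('a :: complex_hilbert_space, 'b :: complex_hilbert_space) operator \<Rightarrow> bool" where
  "densely_defined A \<longleftrightarrow> closure (Domain A) = UNIV"

text \<open>For densely defined operators the following relation is single-valued.\<close>

definition op_adjoint ::
    "('a :: complex_hilbert_space, 'b :: complex_hilbert_space) operator \<Rightarrow> ('b, 'a) operator" where
  "op_adjoint A = {(y, z). \<forall>(x, w)\<in>A. cinner w y = cinner x z}"

definition symmetric_operator :: "('a :: complex_hilbert_space, 'a) operator \<Rightarrow> bool" where
  "symmetric_operator A \<longleftrightarrow> linear_operator A \<and> densely_defined A \<and> A \<subseteq> op_adjoint A"

definition self_adjoint_operator :: "('a :: complex_hilbert_space, 'a) operator \<Rightarrow> bool" where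
  "self_adjoint_operator A \<longleftrightarrow> linear_operator A \<and> densely_defined A \<and> A = op_adjoint A"

definition op_add ::
    "('a :: complex_hilbert_space, 'b :: complex_hilbert_space) operator \<Rightarrow> ('a, 'b) operator
      \<Rightarrow> ('a, 'b) operator" where
  "op_add A B = {(x, y + z) | x y z. (x, y) \<in> A \<and> (x, z) \<in> B}"

definition scalar_operator :: "complex \<Rightarrow> ('a :: complex_hilbert_space, 'a) operator" where
  "scalar_operator c = {(x, c *\<^sub>C x) | x. True}"

definition deficiency_plus :: "('a :: complex_hilbert_space, 'a) operator \<Rightarrow> 'a set" where
  "deficiency_plus A = ortho_complement (Range (op_add A (scalar_operator \<i>)))"

definition deficiency_minus :: "('a :: complex_hilbert_space, 'a) operator \<Rightarrow> 'a set" where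
  "deficiency_minus A = ortho_complement (Range (op_add A (scalar_operator (- \<i>))))"


section \<open>Tensor products\<close>

text \<open>
  \<open>is_hilbert_tensor H K T t\<close> says that the Hilbert space \<open>T\<close> (a closed subspace of its type),
  with \<open>t x y\<close> in the role of the elementary tensor of \<open>x \<in> H\<close> and \<open>y \<in> K\<close>, is the Hilbert
  space tensor product of the Hilbert spaces \<open>H\<close> and \<open>K\<close>. The identity for inner products of
  elementary tensors makes the span of the elementary tensors a copy of the algebraic tensor
  product with its usual inner product; \<open>T\<close> is its completion because it is complete and the
  span is dense in it. These data determine \<open>T\<close> up to a unique unitary compatible with \<open>t\<close>.
\<close>

definition is_hilbert_tensor ::
    "'a :: complex_hilbert_space set \<Rightarrow> 'b :: complex_hilbert_space set \<Rightarrow>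
     'c :: complex_hilbert_space set \<Rightarrow> ('a \<Rightarrow> 'b \<Rightarrow> 'c) \<Rightarrow> bool" where
  "is_hilbert_tensor H K T t \<longleftrightarrow>
     csubspace T \<and> closed T \<and>
     (\<forall>x\<in>H. \<forall>y\<in>K. t x y \<in> T) \<and>
     (\<forall>x\<in>H. \<forall>x'\<in>H. \<forall>y\<in>K. t (x + x') y = t x y + t x' y) \<and>
     (\<forall>x\<in>H. \<forall>y\<in>K. \<forall>y'\<in>K. t x (y + y') = t x y + t x y') \<and>
     (\<forall>c. \<forall>x\<in>H. \<forall>y\<in>K. t (c *\<^sub>C x) y = c *\<^sub>C t x y \<and> t x (c *\<^sub>C y) = c *\<^sub>C t x y) \<and>
     (\<forall>x\<in>H. \<forall>x'\<in>H. \<forall>y\<in>K. \<forall>y'\<in>K. cinner (t x y) (t x' y') = cinner x x' * cinner y y') \<and>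
     closure (cspan {t x y | x y. x \<in> H \<and> y \<in> K}) = T"

text \<open>
  The span is taken in the product space, so that it consists of the pairs
  \<open>(\<Sum>\<^sub>j t f\<^sub>j g\<^sub>j, \<Sum>\<^sub>j t (A f\<^sub>j) (B g\<^sub>j))\<close> with \<open>f\<^sub>j\<close> and \<open>g\<^sub>j\<close> in the domains of \<open>A\<close> and \<open>B\<close>.
\<close>

definition op_tensor ::
    "('a \<Rightarrow> 'b \<Rightarrow> 'c :: complex_hilbert_space) \<Rightarrow> ('a, 'a) operator \<Rightarrow> ('b, 'b) operator
      \<Rightarrow> ('c, 'c) operator" where
  "op_tensor t A B = cspan {(t f g, t f' g') | f g f' g'. (f, f') \<in> A \<and> (g, g') \<in> B}"

definition op_hilbert_tensor ::
    "('a \<Rightarrow> 'b \<Rightarrow> 'c :: complex_hilbert_space) \<Rightarrow> ('a, 'a) operator \<Rightarrow> ('b, 'b) operator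
      \<Rightarrow> ('c, 'c) operator" where
  "op_hilbert_tensor t A B = closure (op_tensor t A B)"

end

theory Submission
  imports Defs
begin

text \<open>
  Write \<open>R\<close> for the span of the vectors \<open>A x \<otimes> g + x \<otimes> B g + \<i> x \<otimes> g\<close> with \<open>x \<in> \<D>(A)\<close>, \<open>g \<in> \<D>(B)\<close>.
  Regularizing with the resolvent of \<open>I \<otimes> B\<close>, which commutes with \<open>A \<otimes> I\<close>, shows that
  \<open>\<N>\<^sub>+(H\<^sub>A\<^sub>B) = R\<^sup>\<bottom>\<close>. Let \<open>A'\<close> be the restriction of the adjoint of \<open>A\<close> to
  \<open>\<D>(A) + \<N>\<^sub>+(A)\<close>. It is dissipative and \<open>A' + \<i>\<close> has dense range, so
  \<open>A' \<otimes> I + I \<otimes> B + \<i>\<close> is bounded below by \<open>1\<close> and, by the same regularization, has dense range.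
  Consequently \<open>\<phi> \<mapsto> P (2\<i> + I \<otimes> B) \<phi>\<close>, with \<open>P\<close> the projection onto \<open>\<N>\<^sub>+(H\<^sub>A\<^sub>B)\<close>, maps
  the algebraic tensor product of \<open>\<N>\<^sub>+(A)\<close> and \<open>\<D>(B)\<close> injectively onto a dense subspace of
  \<open>\<N>\<^sub>+(H\<^sub>A\<^sub>B)\<close>. Orthonormalizing a countable total family and its image by the Gram-Schmidt
  process yields the isometry. The space \<open>\<N>\<^sub>-\<close> is handled by passing to \<open>- A\<close> and \<open>- B\<close>.
\<close>

section \<open>Complex inner products\<close>

lemma cinner_add_left: "cinner (x + y) z = cinner x z + cinner y z"
  by (metis cinner_add_right cinner_commute complex_cnj_add)

lemma cinner_scaleC_left: "cinner (c *\<^sub>C x) y = cnj c * cinner x y"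
  by (metis cinner_commute cinner_scaleC_right complex_cnj_mult)

lemma cinner_zero [simp]: "cinner 0 x = 0" "cinner x 0 = 0"
  using cinner_add_left[of 0 0 x] cinner_add_right[of x 0 0] by auto

lemma cinner_minus_left: "cinner (- x) y = - cinner x y"
  using cinner_add_left[of "- x" x y] by (simp add: eq_neg_iff_add_eq_0)

lemma cinner_minus_right: "cinner x (- y) = - cinner x y"
  using cinner_add_right[of x "- y" y] by (simp add: eq_neg_iff_add_eq_0)

lemma cinner_diff_left: "cinner (x - y) z = cinner x z - cinner y z"
  using cinner_add_left[of x "- y" z] by (simp add: cinner_minus_left)

lemma cinner_diff_right: "cinner x (y - z) = cinner x y - cinner x z"
  using cinner_add_right[of x y "- z"] by (simp add: cinner_minus_right)

lemma cinner_sum_right: "cinner x (\<Sum>i\<in>I. f i) = (\<Sum>i\<in>I. cinner x (f i))"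
  by (induction I rule: infinite_finite_induct) (auto simp: cinner_add_right)

lemmas cinner_simps = cinner_add_left cinner_add_right cinner_diff_left cinner_diff_right
  cinner_minus_left cinner_minus_right cinner_scaleC_left cinner_scaleC_right

lemma cinner_self: "cinner x x = of_real ((norm x)\<^sup>2)"
proof -
  have "Im (cinner x x) = 0"
    using arg_cong[OF cinner_commute[of x x], of Im] by simp
  then show ?thesis
    by (simp add: complex_eq_iff power2_norm_eq_inner inner_eq_Re_cinner)
qed

lemma cinner_self_eq_0 [simp]: "cinner x x = 0 \<longleftrightarrow> x = 0"
  by (simp add: cinner_self)

lemma cinner_eq_0_commute: "cinner x y = 0 \<longleftrightarrow> cinner y x = 0"
  by (metis cinner_commute complex_cnj_zero)

lemma norm_scaleC: "norm (c *\<^sub>C x) = cmod c * norm (x :: 'a :: complex_hilbert_space)"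
proof -
  have "cinner (c *\<^sub>C x) (c *\<^sub>C x) = (c * cnj c) * cinner x x"
    by (simp add: cinner_scaleC_left cinner_scaleC_right)
  then have "complex_of_real ((norm (c *\<^sub>C x))\<^sup>2) = of_real ((cmod c * norm x)\<^sup>2)"
    unfolding cinner_self power_mult_distrib of_real_mult complex_norm_square .
  then have "(norm (c *\<^sub>C x))\<^sup>2 = (cmod c * norm x)\<^sup>2"
    using of_real_eq_iff by blast
  then show ?thesis
    by (simp add: power2_eq_iff_nonneg)
qed

text \<open>A suitable phase makes the inner product real and nonnegative, which reduces the claim
  to the real Cauchy-Schwarz inequality.\<close>

lemma norm_cinner_le: "cmod (cinner x y) \<le> norm x * norm y"
proof (cases "cinner x y = 0")
  case False
  define c where "c = cnj (cinner x y) / cmod (cinner x y)"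
  have c: "cmod c = 1"
    using False by (simp add: c_def norm_divide)
  have "c * cinner x y = cmod (cinner x y)"
    using False complex_norm_square[of "cinner x y"]
    by (simp add: c_def field_simps power2_eq_square)
  then have "cmod (cinner x y) = inner x (c *\<^sub>C y)"
    by (simp add: inner_eq_Re_cinner cinner_simps)
  also have "\<dots> \<le> norm x * norm (c *\<^sub>C y)"
    by (rule norm_cauchy_schwarz)
  finally show ?thesis
    by (simp add: norm_scaleC c)
qed simp

lemma scaleC_minus_one: "(- 1) *\<^sub>C x = - (x :: 'a :: complex_hilbert_space)"
  by (metis complex_vector.scale_minus_left scaleC_one)

lemma bounded_bilinear_cinner: "bounded_bilinear cinner"
proof
  show "\<exists>K. \<forall>a b :: 'a. norm (cinner a b) \<le> norm a * norm b * K"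
    by (rule exI[of _ 1]) (simp add: norm_cinner_le)
qed (simp_all add: cinner_simps scaleR_scaleC scaleC_complex_def)

lemmas tendsto_cinner = bounded_bilinear.tendsto[OF bounded_bilinear_cinner]

lemma bounded_linear_scaleC: "bounded_linear (\<lambda>x. c *\<^sub>C (x :: 'a :: complex_hilbert_space))"
proof
  show "\<exists>K. \<forall>x :: 'a. norm (c *\<^sub>C x) \<le> norm x * K"
    by (rule exI[of _ "cmod c"]) (simp add: norm_scaleC)
qed (simp_all add: scaleC_add_right scaleR_scaleC scaleC_scaleC mult.commute)

lemmas tendsto_scaleC = bounded_linear.tendsto[OF bounded_linear_scaleC]

section \<open>Closed spans, orthogonal complements and linear images\<close>

lemma csubspace_closure:
  assumes "csubspace S"
  shows "csubspace (closure S)"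
proof (rule complex_vector.subspaceI)
  show "0 \<in> closure S"
    using assms closure_subset complex_vector.subspace_0 by blast
next
  fix x y assume "x \<in> closure S" "y \<in> closure S"
  then obtain f g where "\<And>n. f n \<in> S" "f \<longlonglongrightarrow> x" "\<And>n. g n \<in> S" "g \<longlonglongrightarrow> y"
    by (auto simp: closure_sequential)
  then show "x + y \<in> closure S"
    unfolding closure_sequential using assms
    by (intro exI[of _ "\<lambda>n. f n + g n"]) (auto intro: tendsto_add complex_vector.subspace_add)
next
  fix c x assume "x \<in> closure S"
  then obtain f where "\<And>n. f n \<in> S" "f \<longlonglongrightarrow> x"
    by (auto simp: closure_sequential)
  then show "c *\<^sub>C x \<in> closure S"
    unfolding closure_sequential using assms
    by (intro exI[of _ "\<lambda>n. c *\<^sub>C f n"]) (auto intro: tendsto_scaleC complex_vector.subspace_scale)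
qed

lemma csubspace_closure_cspan: "csubspace (closure (cspan S))"
  by (rule csubspace_closure) (rule complex_vector.subspace_span)

lemma closure_cspan_minimal: "S \<subseteq> V \<Longrightarrow> csubspace V \<Longrightarrow> closed V \<Longrightarrow> closure (cspan S) \<subseteq> V"
  by (intro closure_minimal complex_vector.span_minimal)

lemma closure_cspan_superset: "S \<subseteq> closure (cspan S)"
  using closure_subset complex_vector.span_superset by blast

lemma ortho_complement_csubspace: "csubspace (ortho_complement S)"
  by (rule complex_vector.subspaceI) (auto simp: ortho_complement_def cinner_simps)

lemma ortho_complement_closed: "closed (ortho_complement S)"
  unfolding closed_sequential_limits
proof safe
  fix f l assume f: "\<forall>n. f n \<in> ortho_complement S" "f \<longlonglongrightarrow> l"
  have "cinner x l = 0" if "x \<in> S" for x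
  proof -
    have "(\<lambda>n. cinner x (f n)) \<longlonglongrightarrow> cinner x l"
      by (intro tendsto_cinner f tendsto_const)
    then show ?thesis
      using f(1) that by (simp add: ortho_complement_def LIMSEQ_const_iff)
  qed
  then show "l \<in> ortho_complement S"
    by (simp add: ortho_complement_def)
qed

lemma subset_ortho_complement_commute: "S \<subseteq> ortho_complement T \<longleftrightarrow> T \<subseteq> ortho_complement S"
  unfolding ortho_complement_def by (subst cinner_eq_0_commute) blast

lemma ortho_complement_antimono: "S \<subseteq> T \<Longrightarrow> ortho_complement T \<subseteq> ortho_complement S"
  by (auto simp: ortho_complement_def)

text \<open>The double orthogonal complement is a closed subspace containing \<open>S\<close>, hence
  it contains the closed span; the Galois connection turns this into the harder inclusion.\<close>

lemma ortho_complement_closure_cspan: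
  "ortho_complement (closure (cspan S)) = ortho_complement S"
proof
  show "ortho_complement (closure (cspan S)) \<subseteq> ortho_complement S"
    by (intro ortho_complement_antimono closure_cspan_superset)
  have "closure (cspan S) \<subseteq> ortho_complement (ortho_complement S)"
    by (intro closure_cspan_minimal ortho_complement_csubspace ortho_complement_closed)
      (simp add: subset_ortho_complement_commute[of S])
  then show "ortho_complement S \<subseteq> ortho_complement (closure (cspan S))"
    by (subst subset_ortho_complement_commute)
qed

lemma csubspace_image:
  assumes "\<And>x y. L (x + y) = L x + L y" "\<And>c x. L (c *\<^sub>C x) = c *\<^sub>C L x" "csubspace S"
  shows "csubspace (L ` S)"
proof -
  have "L 0 = 0"
    using assms(1)[of 0 0] by simp
  then show ?thesis
    using assms(3) unfolding complex_vector.subspace_def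
    by (auto simp: image_iff Bex_def) (metis assms(1,2))+
qed

lemma cspan_image:
  assumes "\<And>x y. L (x + y) = L x + L y" "\<And>c x. L (c *\<^sub>C x) = c *\<^sub>C L x"
  shows "L ` cspan S = cspan (L ` S)"
proof
  show "cspan (L ` S) \<subseteq> L ` cspan S"
    by (intro complex_vector.span_minimal csubspace_image assms complex_vector.subspace_span)
      (auto intro: complex_vector.span_base)
  have "L 0 = 0"
    using assms(1)[of 0 0] by simp
  then have "csubspace (L -` cspan (L ` S))"
    using complex_vector.subspace_span[of "L ` S"] unfolding complex_vector.subspace_def
    by (auto simp: assms)
  then have "cspan S \<subseteq> L -` cspan (L ` S)"
    by (intro complex_vector.span_minimal) (auto intro: complex_vector.span_base)
  then show "L ` cspan S \<subseteq> cspan (L ` S)"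
    by blast
qed

lemma fst_scaleC: "fst (c *\<^sub>C z) = c *\<^sub>C fst z" and snd_scaleC: "snd (c *\<^sub>C z) = c *\<^sub>C snd z"
  by (auto simp: scaleC_prod_def)

lemmas cspan_fst_image = cspan_image[of fst, OF fst_add fst_scaleC]
lemmas cspan_snd_image = cspan_image[of snd, OF snd_add snd_scaleC]

lemma csubspace_imp_subspace: "csubspace S \<Longrightarrow> subspace S"
  by (auto simp: subspace_def complex_vector.subspace_def scaleR_scaleC)

section \<open>The projection theorem\<close>

lemma norm_diff_parallelogram:
  fixes a b :: "'a :: real_inner"
  shows "(norm (b - a))\<^sup>2 = 2 * (norm a)\<^sup>2 + 2 * (norm b)\<^sup>2 - (norm (a + b))\<^sup>2"
  by (simp add: power2_norm_eq_inner inner_simps inner_commute)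

text \<open>A minimizing sequence is Cauchy by the parallelogram law, since midpoints of its members
  stay in \<open>V\<close> and so have distance at least \<open>d\<close> from
  \<open>x\<close>.\<close>

lemma closest_point_ex:
  fixes V :: "'a :: complex_hilbert_space set"
  assumes V: "csubspace V" "closed V"
  shows "\<exists>p\<in>V. \<forall>m\<in>V. norm (x - p) \<le> norm (x - m)"
proof -
  define d where "d = Inf ((\<lambda>m. norm (x - m)) ` V)"
  have V0: "0 \<in> V"
    using V complex_vector.subspace_0 by blast
  have bdd: "bdd_below ((\<lambda>m. norm (x - m)) ` V)"
    by (rule bdd_belowI[of _ 0]) auto
  have d_le: "d \<le> norm (x - m)" if "m \<in> V" for m
    unfolding d_def using that by (intro cInf_lower bdd) auto
  have "d \<ge> 0"
    unfolding d_def using V0 by (intro cInf_greatest) auto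
  have "\<exists>m\<in>V. norm (x - m) < d + 1 / Suc n" for n
    using cInf_lessD[of "(\<lambda>m. norm (x - m)) ` V" "d + 1 / Suc n"] V0
    by (auto simp: d_def)
  then obtain m where m: "\<And>n. m n \<in> V" "\<And>n. norm (x - m n) < d + 1 / Suc n"
    by metis
  have lim_d: "(\<lambda>n. norm (x - m n)) \<longlonglongrightarrow> d"
  proof (rule tendsto_sandwich[of "\<lambda>_. d" _ _ "\<lambda>n. d + 1 / Suc n"])
    show "(\<lambda>n. d + 1 / real (Suc n)) \<longlonglongrightarrow> d"
      using tendsto_add[OF tendsto_const LIMSEQ_inverse_real_of_nat, of d]
      by (simp add: inverse_eq_divide)
  qed (use m d_le in \<open>auto simp del: of_nat_Suc intro!: always_eventually less_imp_le\<close>)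
  have par: "(norm (m i - m j))\<^sup>2 \<le> 2 * (norm (x - m i))\<^sup>2 + 2 * (norm (x - m j))\<^sup>2 - 4 * d\<^sup>2" for i j
  proof -
    have "(1/2) *\<^sub>R (m i + m j) \<in> V"
      using V m by (simp add: scaleR_scaleC complex_vector.subspace_add complex_vector.subspace_scale)
    then have "d\<^sup>2 \<le> (norm (x - (1/2) *\<^sub>R (m i + m j)))\<^sup>2"
      using d_le \<open>d \<ge> 0\<close> by (intro power_mono) auto
    moreover have "(norm (m i - m j))\<^sup>2 = 2 * (norm (x - m i))\<^sup>2 + 2 * (norm (x - m j))\<^sup>2
        - (norm (2 *\<^sub>R (x - (1/2) *\<^sub>R (m i + m j))))\<^sup>2"
    proof -
      have "2 *\<^sub>R (x - (1/2) *\<^sub>R (m i + m j)) = (x - m i) + (x - m j)" (is "_ = ?a + ?b")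
        by (simp add: scaleR_diff_right scaleR_2)
      moreover have "m i - m j = ?b - ?a"
        by simp
      moreover have "(norm (?b - ?a))\<^sup>2 = 2 * (norm ?a)\<^sup>2 + 2 * (norm ?b)\<^sup>2 - (norm (?a + ?b))\<^sup>2"
        by (rule norm_diff_parallelogram)
      ultimately show ?thesis by simp
    qed
    ultimately show ?thesis by (simp add: power_mult_distrib)
  qed
  have "Cauchy m"
  proof (rule metric_CauchyI)
    fix e :: real assume "e > 0"
    have "(\<lambda>n. (norm (x - m n))\<^sup>2) \<longlonglongrightarrow> d\<^sup>2"
      by (intro tendsto_power lim_d)
    \<comment> \<open>The margin \<open>e\<^sup>2 / 4\<close> enters \<open>par\<close> twice with
      factor 2, which adds up to \<open>e\<^sup>2\<close>.\<close>
    then have "\<forall>\<^sub>F n in sequentially. (norm (x - m n))\<^sup>2 < d\<^sup>2 + e\<^sup>2 / 4"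
      using \<open>e > 0\<close> by (intro order_tendstoD) auto
    then obtain N where N: "\<And>n. n \<ge> N \<Longrightarrow> (norm (x - m n))\<^sup>2 < d\<^sup>2 + e\<^sup>2 / 4"
      by (auto simp: eventually_sequentially)
    have "dist (m i) (m j) < e" if "i \<ge> N" "j \<ge> N" for i j
    proof -
      have "(norm (m i - m j))\<^sup>2 < e\<^sup>2"
        using par[of i j] N[OF that(1)] N[OF that(2)] by linarith
      then show ?thesis
        using \<open>e > 0\<close> by (simp add: dist_norm power2_less_imp_less)
    qed
    then show "\<exists>M. \<forall>i\<ge>M. \<forall>j\<ge>M. dist (m i) (m j) < e"
      by blast
  qed
  then obtain p where p: "m \<longlonglongrightarrow> p"
    by (auto simp: Cauchy_convergent_iff convergent_def)
  have "p \<in> V"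
    using V(2) p m(1) closed_sequentially by blast
  moreover have "norm (x - p) = d"
    using lim_d by (rule LIMSEQ_unique[rotated]) (intro tendsto_intros p)
  ultimately show ?thesis
    using d_le by auto
qed

lemma projection_ex:
  fixes V :: "'a :: complex_hilbert_space set"
  assumes V: "csubspace V" "closed V"
  shows "\<exists>p\<in>V. x - p \<in> ortho_complement V"
proof -
  obtain p where p: "p \<in> V" "\<And>m. m \<in> V \<Longrightarrow> norm (x - p) \<le> norm (x - m)"
    using closest_point_ex[OF V] by blast
  have "convex V"
    unfolding convex_def using V(1)
    by (auto simp: scaleR_scaleC complex_vector.subspace_add complex_vector.subspace_scale)
  \<comment> \<open>The obtuse-angle inequality at the closest point \<open>p\<close>, tested at
    \<open>p + m\<close>; using it for \<open>m\<close> and \<open>- m\<close> gives an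
    equality.\<close>
  have le: "inner (x - p) m \<le> 0" if "m \<in> V" for m
    using any_closest_point_dot[OF \<open>convex V\<close> V(2) p(1), of "p + m" x] p that V(1)
    by (auto simp: dist_norm complex_vector.subspace_add)
  have eq: "inner m (x - p) = 0" if "m \<in> V" for m
    using le[OF that] le[of "- m"] that V(1) complex_vector.subspace_neg[of V m]
    by (simp add: inner_commute)
  have "cinner m (x - p) = 0" if "m \<in> V" for m
  proof (rule complex_eqI)
    show "Re (cinner m (x - p)) = Re 0"
      using eq[OF that] by (simp add: inner_eq_Re_cinner)
    \<comment> \<open>Testing with \<open>\<i> *\<^sub>C m\<close>, which again lies in
      \<open>V\<close>, rotates the imaginary part into the real part.\<close>
    show "Im (cinner m (x - p)) = Im 0"
      using eq[of "\<i> *\<^sub>C m"] that V(1)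
      by (simp add: inner_eq_Re_cinner cinner_simps complex_vector.subspace_scale)
  qed
  then show ?thesis
    using p by (auto simp: ortho_complement_def)
qed

text \<open>The component orthogonal to \<open>V\<close> of a vector of \<open>W\<close> lies again
  in \<open>W\<close>, so it falls under the last hypothesis and vanishes.\<close>

lemma closed_csubspace_eqI:
  fixes V W :: "'a :: complex_hilbert_space set"
  assumes V: "csubspace V" "closed V" and W: "csubspace W" and "V \<subseteq> W"
    and *: "\<And>y. y \<in> W \<Longrightarrow> y \<in> ortho_complement V \<Longrightarrow> y = 0"
  shows "V = W"
proof
  show "W \<subseteq> V"
  proof
    fix x assume "x \<in> W"
    obtain p where p: "p \<in> V" "x - p \<in> ortho_complement V"
      using projection_ex[OF V] by blast
    have "x - p \<in> W"
      using \<open>x \<in> W\<close> p \<open>V \<subseteq> W\<close> W by (auto intro: complex_vector.subspace_diff)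
    then show "x \<in> V"
      using * p by force
  qed
qed fact

lemma closure_csubspace_eq_UNIV:
  fixes V :: "'a :: complex_hilbert_space set"
  assumes "csubspace V" and "\<And>y. y \<in> ortho_complement V \<Longrightarrow> y = 0"
  shows "closure V = UNIV"
proof (rule closed_csubspace_eqI)
  fix y assume "y \<in> ortho_complement (closure V)"
  then show "y = 0"
    using ortho_complement_antimono[OF closure_subset, of V] assms(2) by blast
qed (auto simp: csubspace_closure assms complex_vector.subspace_UNIV)

lemma ortho_complement_ortho_complement:
  fixes V :: "'a :: complex_hilbert_space set"
  assumes "csubspace V"
  shows "ortho_complement (ortho_complement V) = closure V"
proof (rule sym, rule closed_csubspace_eqI)
  show "closure V \<subseteq> ortho_complement (ortho_complement V)"
    by (intro closure_minimal ortho_complement_closed) (simp add: subset_ortho_complement_commute[of V])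
  fix y assume "y \<in> ortho_complement (ortho_complement V)" "y \<in> ortho_complement (closure V)"
  moreover from this(2) have "y \<in> ortho_complement V"
    using ortho_complement_antimono[OF closure_subset, of V] by blast
  ultimately have "cinner y y = 0"
    unfolding ortho_complement_def by blast
  then show "y = 0" by simp
qed (auto simp: csubspace_closure assms ortho_complement_csubspace)

section \<open>Isometries of closed spans\<close>

lemma isometrically_isomorphic_trans:
  assumes "isometrically_isomorphic A B" "isometrically_isomorphic B C"
  shows "isometrically_isomorphic A C"
proof -
  obtain U where U: "bij_betw U A B" "\<forall>x\<in>A. \<forall>y\<in>A. U (x + y) = U x + U y"
    "\<forall>c. \<forall>x\<in>A. U (c *\<^sub>C x) = c *\<^sub>C U x" "\<forall>x\<in>A. norm (U x) = norm x"
    using assms(1) unfolding isometrically_isomorphic_def by blast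
  obtain V where V: "bij_betw V B C" "\<forall>x\<in>B. \<forall>y\<in>B. V (x + y) = V x + V y"
    "\<forall>c. \<forall>x\<in>B. V (c *\<^sub>C x) = c *\<^sub>C V x" "\<forall>x\<in>B. norm (V x) = norm x"
    using assms(2) unfolding isometrically_isomorphic_def by blast
  have "U x \<in> B" if "x \<in> A" for x
    using U(1) that by (auto simp: bij_betw_def)
  then show ?thesis
    unfolding isometrically_isomorphic_def using U V
    by (intro exI[of _ "V \<circ> U"]) (auto intro: bij_betw_trans)
qed

text \<open>The difference of two pairs sharing one coordinate has norm zero in the other, so an
  isometric linear relation is the graph of an injective map. This allows isometries to be built
  from spans of pairs.\<close>

lemma isometrically_isomorphic_graph:
  fixes G :: "('a :: complex_hilbert_space \<times> 'b :: complex_hilbert_space) set"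
  assumes G: "csubspace G" and norm: "\<And>z. z \<in> G \<Longrightarrow> norm (fst z) = norm (snd z)"
  shows "isometrically_isomorphic (fst ` G) (snd ` G)"
proof -
  have eq: "x = x' \<longleftrightarrow> y = y'" if "(x, y) \<in> G" "(x', y') \<in> G" for x y x' y'
  proof -
    have "(x - x', y - y') \<in> G"
      using complex_vector.subspace_diff[OF G that] by simp
    then show ?thesis
      using norm by fastforce
  qed
  define U where "U x = (SOME y. (x, y) \<in> G)" for x
  have U: "(x, U x) \<in> G" if "x \<in> fst ` G" for x
    unfolding U_def using that by (auto intro: someI)
  have UI: "U x = y" if "(x, y) \<in> G" for x y
    using eq[OF that U[of x]] that by force
  show ?thesis
    unfolding isometrically_isomorphic_def
  proof (intro exI[of _ U] conjI ballI allI)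
    show "bij_betw U (fst ` G) (snd ` G)"
    proof (rule bij_betw_imageI)
      show "inj_on U (fst ` G)"
        using eq[OF U U] by (intro inj_onI) blast
      have "y \<in> U ` fst ` G" if "(x, y) \<in> G" for x y
        using UI[OF that] that by force
      then show "U ` fst ` G = snd ` G"
        using U by force
    qed
    show "U (x + y) = U x + U y" if "x \<in> fst ` G" "y \<in> fst ` G" for x y
      using complex_vector.subspace_add[OF G U[OF that(1)] U[OF that(2)]] by (auto intro: UI)
    show "U (c *\<^sub>C x) = c *\<^sub>C U x" if "x \<in> fst ` G" for c x
      using complex_vector.subspace_scale[OF G U[OF that], of c] by (auto intro: UI simp: scaleC_prod_def)
    show "norm (U x) = norm x" if "x \<in> fst ` G" for x
      using norm[OF U[OF that]] by simp
  qed
qed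

text \<open>The lower bound persists on the closure by continuity, and a linear map bounded below
  sends complete subspaces to complete, hence closed, ones.\<close>

lemma image_closure_bounded_below:
  fixes V :: "'a :: complex_hilbert_space set" and p :: "'a \<Rightarrow> 'b :: complex_hilbert_space"
  assumes V: "csubspace V" and p: "bounded_linear p" and "e > 0"
    and le: "\<And>z. z \<in> V \<Longrightarrow> e * norm z \<le> norm (p z)"
  shows "p ` closure V = closure (p ` V)"
proof
  show "p ` closure V \<subseteq> closure (p ` V)"
    by (rule closure_bounded_linear_image_subset[OF p])
  have "closed {z. e * norm z \<le> norm (p z)}"
    by (intro closed_Collect_le continuous_intros linear_continuous_on p)
  then have "closure V \<subseteq> {z. e * norm z \<le> norm (p z)}"
    using le by (intro closure_minimal) auto
  then have "complete (p ` closure V)"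
    using \<open>e > 0\<close> p csubspace_imp_subspace[OF csubspace_closure[OF V]]
    by (intro complete_isometric_image[of e]) (auto simp: complete_eq_closed mult.commute)
  then show "closure (p ` V) \<subseteq> p ` closure V"
    using closure_subset by (intro closure_minimal) (auto simp: complete_eq_closed)
qed

lemma isometrically_isomorphic_closure_graph:
  fixes G :: "('a :: complex_hilbert_space \<times> 'b :: complex_hilbert_space) set"
  assumes G: "csubspace G" and norm: "\<And>z. z \<in> G \<Longrightarrow> norm (fst z) = norm (snd z)"
  shows "isometrically_isomorphic (closure (fst ` G)) (closure (snd ` G))"
proof -
  \<comment> \<open>The coordinates of a pair in \<open>G\<close> have equal norms, so each carries
    at least half of the norm of the pair.\<close>
  have le: "1/2 * norm z \<le> norm (fst z)" "1/2 * norm z \<le> norm (snd z)" if "z \<in> G" for z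
    using norm_Pair_le[of "fst z" "snd z"] norm[OF that] by auto
  have "fst ` closure G = closure (fst ` G)"
    by (rule image_closure_bounded_below[OF G bounded_linear_fst _ le(1)]) auto
  moreover have "snd ` closure G = closure (snd ` G)"
    by (rule image_closure_bounded_below[OF G bounded_linear_snd _ le(2)]) auto
  moreover have "isometrically_isomorphic (fst ` closure G) (snd ` closure G)"
  proof (rule isometrically_isomorphic_graph)
    have "closed {z :: 'a \<times> 'b. norm (fst z) = norm (snd z)}"
      by (intro closed_Collect_eq continuous_intros)
    then have "closure G \<subseteq> {z. norm (fst z) = norm (snd z)}"
      using norm by (intro closure_minimal) auto
    then show "norm (fst z) = norm (snd z)" if "z \<in> closure G" for z
      using that by blast
  qed (intro csubspace_closure G)
  ultimately show ?thesis by simp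
qed

text \<open>Inner products of linear combinations are determined by those of the generators, so
  pairing families with equal Gram matrices spans an isometric graph.\<close>

lemma isometrically_isomorphic_spans:
  fixes f :: "'i \<Rightarrow> 'a :: complex_hilbert_space" and g :: "'i \<Rightarrow> 'b :: complex_hilbert_space"
  assumes "\<And>i j. i \<in> I \<Longrightarrow> j \<in> I \<Longrightarrow> cinner (f i) (f j) = cinner (g i) (g j)"
  shows "isometrically_isomorphic (closure (cspan (f ` I))) (closure (cspan (g ` I)))"
proof -
  define S where "S = (\<lambda>i. (f i, g i)) ` I"
  \<comment> \<open>The pairs whose coordinates have equal inner products with those of every
    element of \<open>W\<close>. Being a subspace, \<open>V W\<close> extends the hypothesis to the
    span one argument at a time: first with \<open>W = S\<close>, then with
    \<open>W = cspan S\<close>.\<close>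
  define V where "V W = {z. \<forall>w\<in>W. cinner (fst w) (fst z) = cinner (snd w) (snd z)}"
    for W :: "('a \<times> 'b) set"
  have V: "csubspace (V W)" for W
    unfolding V_def
    by (rule complex_vector.subspaceI) (auto simp: cinner_simps scaleC_prod_def)
  have "cspan S \<subseteq> V S"
    by (intro complex_vector.span_minimal V) (auto simp: V_def S_def assms)
  have "cinner (fst w) (fst z) = cinner (snd w) (snd z)" if "z \<in> S" "w \<in> cspan S" for z w
  proof -
    have "cinner (fst z) (fst w) = cinner (snd z) (snd w)"
      using \<open>cspan S \<subseteq> V S\<close> that unfolding V_def by blast
    then show ?thesis
      by (metis cinner_commute)
  qed
  then have "S \<subseteq> V (cspan S)"
    by (auto simp: V_def)
  then have "cspan S \<subseteq> V (cspan S)"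
    by (intro complex_vector.span_minimal V)
  then have "cinner (fst z) (fst z) = cinner (snd z) (snd z)" if "z \<in> cspan S" for z
    using that by (auto simp: V_def)
  then have "norm (fst z) = norm (snd z)" if "z \<in> cspan S" for z
    using that unfolding cinner_self of_real_eq_iff by simp
  then have "isometrically_isomorphic (closure (fst ` cspan S)) (closure (snd ` cspan S))"
    by (intro isometrically_isomorphic_closure_graph complex_vector.subspace_span)
  then show ?thesis
    by (simp add: cspan_fst_image cspan_snd_image S_def image_image)
qed

section \<open>Gram-Schmidt orthonormalization\<close>

text \<open>Since \<open>sgn 0 = 0\<close>, vectors depending on their predecessors are sent to \<open>0\<close>.\<close>

fun gram_schmidt :: "(nat \<Rightarrow> 'a :: complex_hilbert_space) \<Rightarrow> nat \<Rightarrow> 'a" where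
  "gram_schmidt v n = sgn (v n - (\<Sum>k<n. cinner (gram_schmidt v k) (v n) *\<^sub>C gram_schmidt v k))"

declare gram_schmidt.simps [simp del]

lemma gram_schmidt_self:
  "cinner (gram_schmidt v n) (gram_schmidt v n) = (if gram_schmidt v n = 0 then 0 else 1)"
  by (subst (1 2 3) gram_schmidt.simps) (simp add: cinner_self norm_sgn sgn_zero_iff)

lemma sgn_scaleC: "sgn (x :: 'a :: complex_hilbert_space) = of_real (inverse (norm x)) *\<^sub>C x"
  by (simp add: sgn_div_norm scaleR_scaleC)

lemma gram_schmidt_orthogonal_less:
  "j < n \<Longrightarrow> cinner (gram_schmidt v j) (gram_schmidt v n) = 0"
proof (induction n arbitrary: j rule: less_induct)
  case (less n)
  let ?e = "gram_schmidt v"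
  have *: "cinner (?e j) (?e k) = (if k = j then cinner (?e j) (?e j) else 0)" if "k < n" for k
  proof (cases j k rule: linorder_cases)
    case greater
    then have "cinner (?e k) (?e j) = 0"
      using less by blast
    then show ?thesis
      using greater cinner_eq_0_commute by auto
  qed (use less that in auto)
  have "cinner (?e j) (v n - (\<Sum>k<n. cinner (?e k) (v n) *\<^sub>C ?e k))
      = cinner (?e j) (v n) - (\<Sum>k<n. cinner (?e k) (v n) * (if k = j then cinner (?e j) (?e j) else 0))"
    by (simp add: cinner_simps cinner_sum_right *)
  also have "\<dots> = cinner (?e j) (v n) * (1 - cinner (?e j) (?e j))"
    using less.prems by (simp add: if_distrib[of "\<lambda>x. _ * x"] algebra_simps cong: if_cong)
  \<comment> \<open>Either \<open>gram_schmidt v j\<close> is a unit vector and the second factor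
    vanishes, or it is zero and the first one does.\<close>
  also have "\<dots> = 0"
    by (simp add: gram_schmidt_self)
  finally show ?case
    by (subst (2) gram_schmidt.simps) (simp add: sgn_scaleC cinner_simps)
qed

lemma cinner_gram_schmidt:
  "cinner (gram_schmidt v i) (gram_schmidt v j) = (if i = j \<and> gram_schmidt v i \<noteq> 0 then 1 else 0)"
proof (cases i j rule: linorder_cases)
  case greater
  then show ?thesis
    using gram_schmidt_orthogonal_less[of j i v] cinner_eq_0_commute by auto
qed (auto simp: gram_schmidt_self gram_schmidt_orthogonal_less)

text \<open>The triangular relation between the two families; \<open>r\<close> is the length before
  normalization.\<close>

lemma gram_schmidt_step:
  obtains s r where "s \<in> cspan (gram_schmidt v ` {..<n})" "v n = of_real r *\<^sub>C gram_schmidt v n + s"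
    "r = 0 \<longleftrightarrow> gram_schmidt v n = 0"
proof
  let ?s = "\<Sum>k<n. cinner (gram_schmidt v k) (v n) *\<^sub>C gram_schmidt v k"
  show "?s \<in> cspan (gram_schmidt v ` {..<n})"
    by (intro complex_vector.span_sum complex_vector.span_scale complex_vector.span_base) auto
  have e: "gram_schmidt v n = sgn (v n - ?s)"
    by (rule gram_schmidt.simps)
  show "v n = of_real (norm (v n - ?s)) *\<^sub>C gram_schmidt v n + ?s"
    unfolding e sgn_scaleC scaleC_scaleC
    by (cases "v n - ?s = 0") (auto simp: scaleC_one simp flip: of_real_mult)
  show "norm (v n - ?s) = 0 \<longleftrightarrow> gram_schmidt v n = 0"
    unfolding e by (simp add: sgn_zero_iff)
qed

lemma cspan_gram_schmidt: "cspan (gram_schmidt v ` {..<n}) = cspan (v ` {..<n})"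
proof (induction n)
  case (Suc n)
  let ?e = "gram_schmidt v"
  obtain s r where s: "s \<in> cspan (?e ` {..<n})" "v n = of_real r *\<^sub>C ?e n + s" "r = 0 \<longleftrightarrow> ?e n = 0"
    by (rule gram_schmidt_step)
  have mono: "cspan (f ` {..<n}) \<subseteq> cspan (f ` {..<Suc n})" for f :: "nat \<Rightarrow> 'a"
    by (intro complex_vector.span_mono) auto
  have "v n \<in> cspan (?e ` {..<Suc n})"
    by (subst s(2), intro complex_vector.span_add complex_vector.span_scale)
      (use s(1) mono[of ?e] in \<open>auto intro: complex_vector.span_base\<close>)
  then have 1: "v ` {..<Suc n} \<subseteq> cspan (?e ` {..<Suc n})"
    using mono[of ?e] Suc by (auto simp: lessThan_Suc intro: complex_vector.span_base)
  have "?e n = of_real (inverse r) *\<^sub>C (v n - s)"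
    using s(3) by (cases "r = 0") (auto simp: s(2) scaleC_scaleC scaleC_one simp flip: of_real_mult)
  moreover have "v n - s \<in> cspan (v ` {..<Suc n})"
    using s(1) mono[of v] Suc by (intro complex_vector.span_diff) (auto intro: complex_vector.span_base)
  ultimately have "?e n \<in> cspan (v ` {..<Suc n})"
    by (metis complex_vector.span_scale)
  then have "?e ` {..<Suc n} \<subseteq> cspan (v ` {..<Suc n})"
    using mono[of v] Suc by (auto simp: lessThan_Suc intro: complex_vector.span_base)
  with 1 show ?case
    by (metis complex_vector.span_eq)
qed simp

text \<open>Each \<open>gram_schmidt v n\<close> is orthogonal to the span of its predecessors,
  which is also the span of the earlier \<open>v k\<close>; if \<open>v n\<close> lies there, its
  normalized remainder is orthogonal to itself.\<close>

lemma gram_schmidt_eq_0_iff: "gram_schmidt v n = 0 \<longleftrightarrow> v n \<in> cspan (v ` {..<n})"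
proof
  let ?e = "gram_schmidt v"
  obtain s r where s: "s \<in> cspan (?e ` {..<n})" "v n = of_real r *\<^sub>C ?e n + s" "r = 0 \<longleftrightarrow> ?e n = 0"
    by (rule gram_schmidt_step)
  {
    assume "?e n = 0"
    then show "v n \<in> cspan (v ` {..<n})"
      using s by (simp add: cspan_gram_schmidt)
  next
    assume "v n \<in> cspan (v ` {..<n})"
    then have "v n - s \<in> cspan (?e ` {..<n})"
      using s(1) by (simp add: cspan_gram_schmidt complex_vector.span_diff)
    then have "of_real r *\<^sub>C ?e n \<in> cspan (?e ` {..<n})"
      by (simp add: s(2))
    moreover have "cspan (?e ` {..<n}) \<subseteq> ortho_complement {?e n}"
      by (intro complex_vector.span_minimal ortho_complement_csubspace)
        (auto simp: ortho_complement_def cinner_gram_schmidt)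
    ultimately have "cinner (?e n) (of_real r *\<^sub>C ?e n) = 0"
      by (auto simp: ortho_complement_def)
    then show "?e n = 0"
      using s(3) by (simp add: cinner_simps)
  }
qed

lemma cspan_range_gram_schmidt: "cspan (range (gram_schmidt v)) = cspan (range v)"
proof -
  have "w n \<in> cspan (u ` {..<Suc n})" if "cspan (w ` {..<Suc n}) = cspan (u ` {..<Suc n})"
    for n and u w :: "nat \<Rightarrow> 'a"
    using that by (metis complex_vector.span_base imageI lessThan_iff lessI)
  moreover have "cspan (u ` {..<n}) \<subseteq> cspan (range u)" for n and u :: "nat \<Rightarrow> 'a"
    by (intro complex_vector.span_mono) auto
  ultimately have "range (gram_schmidt v) \<subseteq> cspan (range v)" "range v \<subseteq> cspan (range (gram_schmidt v))"
    using cspan_gram_schmidt[of v] by blast+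
  then show ?thesis
    by (metis complex_vector.span_eq)
qed

text \<open>
  The hypothesis says that \<open>v n \<mapsto> w n\<close> extends to a linear bijection of the spans; then both
  Gram-Schmidt sequences vanish at the same indices.
\<close>

lemma isometrically_isomorphic_injective_spans:
  fixes v :: "nat \<Rightarrow> 'a :: complex_hilbert_space" and w :: "nat \<Rightarrow> 'b :: complex_hilbert_space"
  assumes inj: "\<And>x y. (x, y) \<in> cspan (range (\<lambda>n. (v n, w n))) \<Longrightarrow> x = 0 \<longleftrightarrow> y = 0"
  shows "isometrically_isomorphic (closure (cspan (range v))) (closure (cspan (range w)))"
proof -
  have eq: "gram_schmidt v n = 0 \<longleftrightarrow> gram_schmidt w n = 0" for n
  proof -
    let ?G = "cspan (range (\<lambda>n. (v n, w n)))" and ?G' = "cspan ((\<lambda>n. (v n, w n)) ` {..<n})"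
    have "?G' \<subseteq> ?G"
      by (intro complex_vector.span_mono) auto
    \<comment> \<open>One \<open>z\<close> witnesses the dependence of both \<open>v n\<close> and
      \<open>w n\<close> on their predecessors, by \<open>inj\<close> applied to the
      difference.\<close>
    then have *: "v n = fst z \<longleftrightarrow> w n = snd z" if "z \<in> ?G'" for z
      using inj[of "v n - fst z" "w n - snd z"] that
        complex_vector.span_diff[of "(v n, w n)" _ z, OF complex_vector.span_base]
      by (cases z) auto
    have "v n \<in> cspan (v ` {..<n}) \<longleftrightarrow> v n \<in> fst ` ?G'"
      by (simp add: cspan_fst_image image_image)
    also have "\<dots> \<longleftrightarrow> w n \<in> snd ` ?G'"
      using * by blast
    also have "\<dots> \<longleftrightarrow> w n \<in> cspan (w ` {..<n})"
      by (simp add: cspan_snd_image image_image)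
    finally show ?thesis
      by (simp add: gram_schmidt_eq_0_iff)
  qed
  have "isometrically_isomorphic (closure (cspan (range (gram_schmidt v))))
      (closure (cspan (range (gram_schmidt w))))"
    by (rule isometrically_isomorphic_spans) (auto simp: cinner_gram_schmidt eq)
  then show ?thesis
    by (simp add: cspan_range_gram_schmidt)
qed

section \<open>Adjoints and symmetric operators\<close>

lemma op_adjointI: "(\<And>x w. (x, w) \<in> A \<Longrightarrow> cinner w y = cinner x z) \<Longrightarrow> (y, z) \<in> op_adjoint A"
  by (auto simp: op_adjoint_def)

lemma op_adjointD: "(y, z) \<in> op_adjoint A \<Longrightarrow> (x, w) \<in> A \<Longrightarrow> cinner w y = cinner x z"
  by (auto simp: op_adjoint_def)

text \<open>Rotating the graph turns the adjoint relation into orthogonality in the direct sum, so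
  adjoints inherit linearity and closedness from complements.\<close>

lemma op_adjoint_eq_ortho_complement:
  "op_adjoint A = ortho_complement ((\<lambda>z. (snd z, - fst z)) ` A)"
  by (force simp: op_adjoint_def ortho_complement_def cinner_prod_def cinner_simps)

lemma csubspace_op_adjoint: "csubspace (op_adjoint A)"
  by (simp add: op_adjoint_eq_ortho_complement ortho_complement_csubspace)

lemma closed_op_adjoint: "closed (op_adjoint A)"
  by (simp add: op_adjoint_eq_ortho_complement ortho_complement_closed)

lemma subset_op_adjoint_swap:
  assumes "B \<subseteq> op_adjoint A"
  shows "A \<subseteq> op_adjoint B"
proof clarify
  fix y z assume yz: "(y, z) \<in> A"
  show "(y, z) \<in> op_adjoint B"
  proof (rule op_adjointI)
    fix x w assume "(x, w) \<in> B"
    then have "cinner z x = cinner y w"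
      using assms yz by (blast intro: op_adjointD)
    then show "cinner w y = cinner x z"
      by (metis cinner_commute)
  qed
qed

lemma subset_op_adjoint_commute: "A \<subseteq> op_adjoint B \<longleftrightarrow> B \<subseteq> op_adjoint A"
  by (rule iffI; rule subset_op_adjoint_swap; assumption)

text \<open>\<open>op_adjoint (op_adjoint A)\<close> is a closed subspace containing
  \<open>A\<close>, hence it contains the closed span. Adjoint conditions therefore need checking
  only on generators.\<close>

lemma op_adjoint_closure_cspan: "op_adjoint (closure (cspan A)) = op_adjoint A"
proof
  have "closure (cspan A) \<subseteq> op_adjoint (op_adjoint A)"
    by (intro closure_cspan_minimal csubspace_op_adjoint closed_op_adjoint)
      (simp add: subset_op_adjoint_commute[of A])
  then show "op_adjoint A \<subseteq> op_adjoint (closure (cspan A))"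
    by (simp add: subset_op_adjoint_commute[of "op_adjoint A"])
  show "op_adjoint (closure (cspan A)) \<subseteq> op_adjoint A"
    using closure_cspan_superset[of A] by (force simp: op_adjoint_def)
qed

lemma op_adjoint_cspan: "op_adjoint (cspan A) = op_adjoint A"
  using op_adjoint_closure_cspan[of "cspan A"] op_adjoint_closure_cspan[of A]
  by (simp add: complex_vector.span_span)

lemma symmetric_closure_cspan:
  "A \<subseteq> op_adjoint A \<Longrightarrow> closure (cspan A) \<subseteq> op_adjoint (closure (cspan A))"
  unfolding op_adjoint_closure_cspan
  by (intro closure_cspan_minimal csubspace_op_adjoint closed_op_adjoint)

section \<open>Imaginary shifts of symmetric and self-adjoint operators\<close>

lemma norm_add_imaginary_sq:
  assumes "cinner y x = cinner x y"
  shows "(norm (y + (\<i> * of_real m) *\<^sub>C x))\<^sup>2 = (norm y)\<^sup>2 + m\<^sup>2 * (norm x)\<^sup>2"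
proof -
  \<comment> \<open>By symmetry the cross terms, with coefficients \<open>\<i> * m\<close> and
    \<open>- \<i> * m\<close>, cancel.\<close>
  have "complex_of_real ((norm (y + (\<i> * of_real m) *\<^sub>C x))\<^sup>2)
      = of_real ((norm y)\<^sup>2 + m\<^sup>2 * (norm x)\<^sup>2)"
    unfolding cinner_self[symmetric] of_real_add of_real_mult
    by (simp add: cinner_simps assms power2_eq_square algebra_simps)
  then show ?thesis
    unfolding of_real_eq_iff .
qed

text \<open>The map \<open>p\<close> is bounded below on the closed graph by
  \<open>norm_add_imaginary_sq\<close>, so its image is closed; hypothesis \<open>dense\<close> says
  that the orthogonal complement of the image is trivial.\<close>

lemma symmetric_imaginary_surj:
  fixes S :: "('a :: complex_hilbert_space, 'a) operator"
  assumes S: "csubspace S" "closed S" "S \<subseteq> op_adjoint S" and "m \<noteq> 0"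
    and dense: "\<And>y. (\<And>h h'. (h, h') \<in> S \<Longrightarrow> cinner (h' + (\<i> * of_real m) *\<^sub>C h) y = 0) \<Longrightarrow> y = 0"
  obtains h h' where "(h, h') \<in> S" "h' + (\<i> * of_real m) *\<^sub>C h = g"
proof -
  define p where "p z = snd z + (\<i> * of_real m) *\<^sub>C fst z" for z :: "'a \<times> 'a"
  \<comment> \<open>\<open>(norm (p z))\<^sup>2\<close> weights the squared norms of the coordinates
    by \<open>1\<close> and \<open>m\<^sup>2\<close>, both at least
    \<open>e\<^sup>2\<close>.\<close>
  define e where "e = min 1 \<bar>m\<bar>"
  have "e > 0" "e\<^sup>2 \<le> 1" "e\<^sup>2 \<le> m\<^sup>2"
    using \<open>m \<noteq> 0\<close> by (auto simp: e_def abs_le_square_iff[symmetric] power_le_one)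
  have p: "bounded_linear p"
    unfolding p_def
    by (intro bounded_linear_add bounded_linear_snd
        bounded_linear_compose[OF bounded_linear_scaleC bounded_linear_fst])
  have le: "e * norm z \<le> norm (p z)" if "z \<in> S" for z
  proof (rule power2_le_imp_le)
    have "cinner (snd z) (fst z) = cinner (fst z) (snd z)"
      using S(3) that op_adjointD[of "fst z" "snd z" S "fst z" "snd z"] by auto
    then have "(norm (p z))\<^sup>2 = (norm (snd z))\<^sup>2 + m\<^sup>2 * (norm (fst z))\<^sup>2"
      unfolding p_def by (rule norm_add_imaginary_sq)
    moreover have "(e * norm z)\<^sup>2 = e\<^sup>2 * (norm (snd z))\<^sup>2 + e\<^sup>2 * (norm (fst z))\<^sup>2"
      by (cases z) (simp add: norm_Pair power_mult_distrib algebra_simps)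
    ultimately show "(e * norm z)\<^sup>2 \<le> (norm (p z))\<^sup>2"
      using mult_right_mono[OF \<open>e\<^sup>2 \<le> 1\<close>, of "(norm (snd z))\<^sup>2"]
        mult_right_mono[OF \<open>e\<^sup>2 \<le> m\<^sup>2\<close>, of "(norm (fst z))\<^sup>2"] by simp
  qed simp
  have "p ` S = closure (p ` S)"
    using image_closure_bounded_below[OF S(1) p \<open>e > 0\<close> le] S(2) by (simp add: closure_closed)
  also have "\<dots> = UNIV"
  proof (rule closure_csubspace_eq_UNIV)
    show "csubspace (p ` S)"
      by (intro csubspace_image S) (auto simp: p_def scaleC_prod_def scaleC_add_right scaleC_scaleC mult_ac)
    show "y = 0" if "y \<in> ortho_complement (p ` S)" for y
      using that by (intro dense) (force simp: ortho_complement_def p_def)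
  qed
  finally obtain z where "z \<in> S" "p z = g"
    by (metis UNIV_I imageE)
  then show ?thesis
    by (intro that[of "fst z" "snd z"]) (auto simp: p_def)
qed

lemma self_adjoint_operatorD:
  assumes "self_adjoint_operator B"
  shows "csubspace B" "closed B" "B \<subseteq> op_adjoint B" "closure (Domain B) = UNIV"
  using assms closed_op_adjoint[of B]
  by (auto simp: self_adjoint_operator_def linear_operator_def densely_defined_def)

text \<open>A nonzero vector orthogonal to the range would be an eigenvector of the adjoint, that is
  of \<open>B\<close>, with eigenvalue \<open>\<i> * m\<close>; symmetry forbids this.\<close>

lemma self_adjoint_imaginary_surj:
  assumes B: "self_adjoint_operator B" and "m \<noteq> 0"
  obtains h h' where "(h, h') \<in> B" "h' + (\<i> * of_real m) *\<^sub>C h = g"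
proof (rule symmetric_imaginary_surj[OF self_adjoint_operatorD(1-3)[OF B] \<open>m \<noteq> 0\<close>])
  fix y assume y: "\<And>h h'. (h, h') \<in> B \<Longrightarrow> cinner (h' + (\<i> * of_real m) *\<^sub>C h) y = 0"
  have "(y, (\<i> * of_real m) *\<^sub>C y) \<in> op_adjoint B"
    using y by (intro op_adjointI) (simp add: cinner_simps eq_neg_iff_add_eq_0)
  then have "(y, (\<i> * of_real m) *\<^sub>C y) \<in> B"
    using B unfolding self_adjoint_operator_def by simp
  from op_adjointD[OF _ this] self_adjoint_operatorD(3)[OF B] this
  have "cinner ((\<i> * of_real m) *\<^sub>C y) y = cinner y ((\<i> * of_real m) *\<^sub>C y)"
    by blast
  then show "y = 0"
    using \<open>m \<noteq> 0\<close> by (simp add: cinner_simps)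
qed

text \<open>
  The contraction \<open>x' + \<i> x \<mapsto> x' - \<i> x\<close> given by the Cayley transform of a dissipative operator
  extends to the whole space, and its adjoint is a contraction, too.
\<close>

lemma adjoint_dissipative:
  fixes G :: "('a :: complex_hilbert_space, 'a) operator"
  assumes diss: "\<And>x x'. (x, x') \<in> G \<Longrightarrow> 0 \<le> Im (cinner x x')"
    and dense: "closure {x' + \<i> *\<^sub>C x | x x'. (x, x') \<in> G} = UNIV"
    and yz: "(y, z) \<in> op_adjoint G"
  shows "Im (cinner y z) \<le> 0"
proof -
  \<comment> \<open>This identity converts dissipativity into a contraction estimate and, at the
    end, back again.\<close>
  have norm_diff: "(norm (v + \<i> *\<^sub>C u))\<^sup>2 - (norm (v - \<i> *\<^sub>C u))\<^sup>2 = 4 * Im (cinner u v)" for u v :: 'a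
  proof -
    have "Re (cinner (v + \<i> *\<^sub>C u) (v + \<i> *\<^sub>C u)) - Re (cinner (v - \<i> *\<^sub>C u) (v - \<i> *\<^sub>C u))
        = 4 * Im (cinner u v)"
      using arg_cong[OF cinner_commute[of v u], of Im] by (simp add: cinner_simps)
    then show ?thesis
      by (simp add: cinner_self)
  qed
  \<comment> \<open>The Cayley pair of \<open>(y, z)\<close>: the adjoint relation says that
    \<open>b\<close> tested against \<open>x' + \<i> *\<^sub>C x\<close> equals \<open>a\<close>
    tested against \<open>x' - \<i> *\<^sub>C x\<close>.\<close>
  define a b where "a = z - \<i> *\<^sub>C y" and "b = z + \<i> *\<^sub>C y"
  have "cmod (cinner u b) \<le> norm u * norm a" for u
  proof -
    have "closed {u. cmod (cinner u b) \<le> norm u * norm a}"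
      by (intro closed_Collect_le continuous_intros
          linear_continuous_on bounded_bilinear.bounded_linear_left[OF bounded_bilinear_cinner])
    moreover have "cmod (cinner (x' + \<i> *\<^sub>C x) b) \<le> norm (x' + \<i> *\<^sub>C x) * norm a" if "(x, x') \<in> G" for x x'
    proof -
      have "cinner (x' + \<i> *\<^sub>C x) b = cinner (x' - \<i> *\<^sub>C x) a"
        using op_adjointD[OF yz that] by (simp add: a_def b_def cinner_simps algebra_simps)
      also have "cmod \<dots> \<le> norm (x' - \<i> *\<^sub>C x) * norm a"
        by (rule norm_cinner_le)
      also have "norm (x' - \<i> *\<^sub>C x) \<le> norm (x' + \<i> *\<^sub>C x)"
        by (rule power2_le_imp_le) (use norm_diff[of x' x] diss[OF that] in linarith, simp)
      finally show ?thesis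
        by (simp add: mult_right_mono)
    qed
    ultimately have "closure {x' + \<i> *\<^sub>C x | x x'. (x, x') \<in> G} \<subseteq> {u. cmod (cinner u b) \<le> norm u * norm a}"
      by (intro closure_minimal) auto
    then show ?thesis
      using dense by auto
  qed
  from this[of b] have "norm b \<le> norm a"
    by (cases "b = 0") (auto simp: cinner_self norm_mult power2_eq_square)
  then have "(norm b)\<^sup>2 \<le> (norm a)\<^sup>2"
    by (simp add: power_mono)
  then show ?thesis
    using norm_diff[of z y] unfolding a_def b_def by linarith
qed

lemma cinner_symmetric_real: "S \<subseteq> op_adjoint S \<Longrightarrow> (x, y) \<in> S \<Longrightarrow> Im (cinner x y) = 0"
  using op_adjointD[of x y S x y] arg_cong[OF cinner_commute[of x y], of Im] by (auto simp: subset_iff)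

section \<open>Hilbert tensor products\<close>

lemma hilbert_tensorD:
  assumes "is_hilbert_tensor H UNIV T t"
  shows tensor_add_left: "x \<in> H \<Longrightarrow> x' \<in> H \<Longrightarrow> t (x + x') y = t x y + t x' y"
    and tensor_add_right: "x \<in> H \<Longrightarrow> t x (y + y') = t x y + t x y'"
    and tensor_scaleC_left: "x \<in> H \<Longrightarrow> t (c *\<^sub>C x) y = c *\<^sub>C t x y"
    and tensor_scaleC_right: "x \<in> H \<Longrightarrow> t x (c *\<^sub>C y) = c *\<^sub>C t x y"
    and cinner_tensor: "x \<in> H \<Longrightarrow> x' \<in> H \<Longrightarrow> cinner (t x y) (t x' y') = cinner x x' * cinner y y'"
    and closure_cspan_tensor: "closure (cspan {t x y | x y. x \<in> H}) = T"
  using assms unfolding is_hilbert_tensor_def by (blast, blast, blast, blast, blast, simp)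

lemma norm_tensor:
  assumes "is_hilbert_tensor H UNIV T t" "x \<in> H"
  shows "norm (t x y) = norm x * norm y"
proof -
  have "complex_of_real ((norm (t x y))\<^sup>2) = of_real ((norm x * norm y)\<^sup>2)"
    using cinner_tensor[OF assms(1,2,2), of y y] unfolding cinner_self power_mult_distrib of_real_mult .
  then have "(norm (t x y))\<^sup>2 = (norm x * norm y)\<^sup>2"
    unfolding of_real_eq_iff .
  then show ?thesis
    by (simp add: power2_eq_iff_nonneg)
qed

lemma tendsto_tensor:
  fixes f :: "nat \<Rightarrow> 'a :: complex_hilbert_space"
  assumes t: "is_hilbert_tensor H UNIV T t" and H: "csubspace H"
    and f: "\<And>n. f n \<in> H" "f \<longlonglongrightarrow> x" "x \<in> H" and g: "g \<longlonglongrightarrow> y"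
  shows "(\<lambda>n. t (f n) (g n)) \<longlonglongrightarrow> t x y"
proof -
  \<comment> \<open>Changing one factor at a time leaves elementary tensors, whose norms are
    products.\<close>
  have eq: "t (f n) (g n) - t x y = t (f n - x) (g n) + t x (g n - y)" for n
  proof -
    have "t (f n) (g n) = t (f n - x) (g n) + t x (g n)"
      using tensor_add_left[OF t, of "f n - x" x "g n"] f H complex_vector.subspace_diff by auto
    moreover have "t x (g n) = t x (g n - y) + t x y"
      using tensor_add_right[OF t, of x "g n - y" y] f(3) by simp
    ultimately show ?thesis by simp
  qed
  have lim: "(\<lambda>n. norm (f n - x) * norm (g n) + norm x * norm (g n - y)) \<longlonglongrightarrow> 0 * norm y + norm x * 0"
    by (intro tendsto_intros tendsto_norm_zero LIM_zero f g)
  have le: "norm (t (f n) (g n) - t x y) \<le> norm (f n - x) * norm (g n) + norm x * norm (g n - y)" for n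
    unfolding eq using norm_triangle_ineq[of "t (f n - x) (g n)" "t x (g n - y)"]
    using f H by (simp add: norm_tensor[OF t] complex_vector.subspace_diff)
  have "(\<lambda>n. t (f n) (g n) - t x y) \<longlonglongrightarrow> 0"
    by (rule Lim_null_comparison[OF always_eventually[OF allI, OF le]]) (use lim in simp)
  then show ?thesis
    by (rule LIM_zero_cancel)
qed

lemma tensor_mem_closure:
  assumes t: "is_hilbert_tensor H UNIV T t" and H: "csubspace H"
    and X: "X \<subseteq> H" "x \<in> closure X" "x \<in> H" and Y: "y \<in> closure Y"
  shows "t x y \<in> closure {t x y | x y. x \<in> X \<and> y \<in> Y}"
proof -
  obtain f g where "\<And>n. f n \<in> X" "f \<longlonglongrightarrow> x" "\<And>n. g n \<in> Y" "g \<longlonglongrightarrow> y"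
    using X Y by (auto simp: closure_sequential)
  then show ?thesis
    unfolding closure_sequential using X
    by (intro exI[of _ "\<lambda>n. t (f n) (g n)"] conjI tendsto_tensor[OF t H]) auto
qed

text \<open>Joint continuity puts every elementary tensor into the closure of those from
  \<open>X\<close> and \<open>Y\<close>, so the latter are total.\<close>

lemma ortho_complement_tensors:
  assumes t: "is_hilbert_tensor UNIV UNIV UNIV t"
    and X: "closure X = UNIV" and Y: "closure Y = UNIV"
    and ortho: "\<And>x y. x \<in> X \<Longrightarrow> y \<in> Y \<Longrightarrow> cinner (t x y) z = 0"
  shows "z = 0"
proof -
  let ?S = "{t x y | x y. x \<in> X \<and> y \<in> Y}"
  have "?S \<subseteq> ortho_complement {z}"
    by (subst subset_ortho_complement_commute) (auto simp: ortho_complement_def ortho)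
  then have "closure ?S \<subseteq> ortho_complement {z}"
    by (intro closure_minimal ortho_complement_closed)
  moreover have "t x y \<in> closure ?S" for x y
    using X Y by (intro tensor_mem_closure[OF t]) (auto simp: complex_vector.subspace_UNIV)
  ultimately have "{t x y | x y. x \<in> UNIV} \<subseteq> ortho_complement {z}"
    by blast
  then have "closure (cspan {t x y | x y. x \<in> UNIV}) \<subseteq> ortho_complement {z}"
    by (intro closure_cspan_minimal ortho_complement_closed ortho_complement_csubspace)
  then have "z \<in> ortho_complement {z}"
    using closure_cspan_tensor[OF t] by blast
  then show ?thesis
    by (simp add: ortho_complement_def)
qed

section \<open>Sums of tensor products of operators\<close>

lemma in_closure_subset_zero:
  assumes "x \<in> closure S" "S \<subseteq> {0}"
  shows "x = (0 :: 'a :: real_normed_vector)"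
  using closure_mono[OF assms(2)] assms(1) by auto

lemma csubspace_op_add:
  assumes "csubspace S" "csubspace T"
  shows "csubspace (op_add S T)"
proof (rule complex_vector.subspaceI)
  show "0 \<in> op_add S T"
    using complex_vector.subspace_0[OF assms(1)] complex_vector.subspace_0[OF assms(2)]
    by (force simp: op_add_def zero_prod_def)
next
  fix x y assume "x \<in> op_add S T" "y \<in> op_add S T"
  then obtain a b c a' b' c' where *: "x = (a, b + c)" "(a, b) \<in> S" "(a, c) \<in> T"
      "y = (a', b' + c')" "(a', b') \<in> S" "(a', c') \<in> T"
    by (auto simp: op_add_def)
  have "(a + a', b + b') \<in> S" "(a + a', c + c') \<in> T"
    using complex_vector.subspace_add[OF assms(1) *(2,5)] complex_vector.subspace_add[OF assms(2) *(3,6)]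
    by auto
  then show "x + y \<in> op_add S T"
    unfolding op_add_def * mem_Collect_eq
    by (intro exI[of _ "a + a'"] exI[of _ "b + b'"] exI[of _ "c + c'"]) (simp add: algebra_simps)
next
  fix r x assume "x \<in> op_add S T"
  then obtain a b c where *: "x = (a, b + c)" "(a, b) \<in> S" "(a, c) \<in> T"
    by (auto simp: op_add_def)
  have "(r *\<^sub>C a, r *\<^sub>C b) \<in> S" "(r *\<^sub>C a, r *\<^sub>C c) \<in> T"
    using complex_vector.subspace_scale[OF assms(1) *(2), of r] complex_vector.subspace_scale[OF assms(2) *(3), of r]
    by (auto simp: scaleC_prod_def)
  then show "r *\<^sub>C x \<in> op_add S T"
    unfolding op_add_def * by (auto simp: scaleC_prod_def scaleC_add_right)
qed

lemma Range_op_add_scalar: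
  "Range (op_add S (scalar_operator c)) = (\<lambda>z. snd z + c *\<^sub>C fst z) ` S"
  by (force simp: op_add_def scalar_operator_def)

lemma scaleC_scaleC_commute: "a *\<^sub>C b *\<^sub>C x = b *\<^sub>C a *\<^sub>C (x :: 'a :: complex_hilbert_space)"
  by (simp add: scaleC_scaleC mult.commute)

lemma snd_add_scaleC_fst_linear:
  "snd (x + y) + c *\<^sub>C fst (x + y) = (snd x + c *\<^sub>C fst x) + (snd y + c *\<^sub>C fst y)"
  "snd (a *\<^sub>C x) + c *\<^sub>C fst (a *\<^sub>C x) = a *\<^sub>C (snd x + c *\<^sub>C fst x)"
  by (simp_all add: scaleC_add_right scaleC_prod_def scaleC_scaleC_commute[of c])

lemma mem_deficiency_plus:
  "y \<in> deficiency_plus A \<longleftrightarrow> (\<forall>(x, x')\<in>A. cinner (x' + \<i> *\<^sub>C x) y = 0)"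
  by (auto simp: deficiency_plus_def Range_op_add_scalar ortho_complement_def)

lemma mem_deficiency_plus_iff_adjoint: "y \<in> deficiency_plus A \<longleftrightarrow> (y, \<i> *\<^sub>C y) \<in> op_adjoint A"
  by (auto simp: mem_deficiency_plus op_adjoint_def cinner_simps)

lemma symmetric_operatorD:
  assumes "symmetric_operator A"
  shows "csubspace A" "A \<subseteq> op_adjoint A"
  using assms by (auto simp: symmetric_operator_def linear_operator_def)

text \<open>The graph of \<open>A \<otimes> I + I \<otimes> B\<close> on elementary tensors only;
  adjoints and orthogonal complements depend on generators alone, so the span is taken only where it
  matters.\<close>

definition kronecker_sum ::
    "('a \<Rightarrow> 'b \<Rightarrow> 'c :: complex_hilbert_space) \<Rightarrow> ('a \<times> 'a) set \<Rightarrow> ('b \<times> 'b) set \<Rightarrow> ('c \<times> 'c) set" where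
  "kronecker_sum t A B = {(t x g, t x' g + t x g') | x x' g g'. (x, x') \<in> A \<and> (g, g') \<in> B}"

definition shifted_sums ::
    "('a \<Rightarrow> 'b \<Rightarrow> 'c :: complex_hilbert_space) \<Rightarrow> complex \<Rightarrow> ('a \<times> 'a) set \<Rightarrow> ('b \<times> 'b) set \<Rightarrow> 'c set" where
  "shifted_sums t c A B = (\<lambda>z. snd z + c *\<^sub>C fst z) ` kronecker_sum t A B"

lemma mem_ortho_complement_shifted_sums:
  "y \<in> ortho_complement (shifted_sums t c A B) \<longleftrightarrow>
    (\<forall>x x' g g'. (x, x') \<in> A \<longrightarrow> (g, g') \<in> B \<longrightarrow> cinner (t x' g + t x g' + c *\<^sub>C t x g) y = 0)"
  by (fastforce simp: ortho_complement_def shifted_sums_def kronecker_sum_def)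

lemma op_tensor_Id_right: "op_tensor t A Id = cspan {(t x g, t x' g) | x x' g. (x, x') \<in> A}"
  unfolding op_tensor_def by (rule arg_cong[of _ _ cspan]) auto

lemma op_tensor_Id_left: "op_tensor t Id B = cspan {(t x g, t x g') | x g g'. (g, g') \<in> B}"
  unfolding op_tensor_def by (rule arg_cong[of _ _ cspan]) auto

section \<open>The operator \<open>I \<otimes> B\<close> and regularization by its resolvent\<close>

locale tensor_self_adjoint =
  fixes t :: "'a :: complex_hilbert_space \<Rightarrow> 'b :: complex_hilbert_space \<Rightarrow> 'c :: complex_hilbert_space"
    and B :: "('b, 'b) operator"
  assumes t: "is_hilbert_tensor UNIV UNIV UNIV t" and B: "self_adjoint_operator B"
begin

lemmas t_simps = tensor_add_left[OF t UNIV_I UNIV_I] tensor_add_right[OF t UNIV_I]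
  tensor_scaleC_left[OF t UNIV_I] tensor_scaleC_right[OF t UNIV_I]
lemmas cinner_t = cinner_tensor[OF t UNIV_I UNIV_I]

lemma t_diff_right: "t x (y - z) = t x y - t x z"
  using t_simps(2)[of x "y - z" z] by simp

abbreviation B1 :: "('c, 'c) operator" where
  "B1 \<equiv> op_hilbert_tensor t Id B"

lemma B1_mem: "(g, g') \<in> B \<Longrightarrow> (t x g, t x g') \<in> op_tensor t Id B"
  unfolding op_tensor_Id_left by (rule complex_vector.span_base) auto

lemma B1_mem': "(g, g') \<in> B \<Longrightarrow> (t x g, t x g') \<in> B1"
  unfolding op_hilbert_tensor_def using B1_mem closure_subset by blast

lemma A1_mem: "(x, x') \<in> A \<Longrightarrow> (t x g, t x' g) \<in> op_tensor t A Id"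
  unfolding op_tensor_Id_right by (rule complex_vector.span_base) auto

lemma symmetric_A1:
  assumes "A \<subseteq> op_adjoint A"
  shows "op_hilbert_tensor t A Id \<subseteq> op_adjoint (op_hilbert_tensor t A Id)"
  unfolding op_hilbert_tensor_def op_tensor_Id_right
proof (rule symmetric_closure_cspan, clarify, rule op_adjointI, clarify)
  fix x x' g y y' h assume "(x, x') \<in> A" "(y, y') \<in> A"
  then show "cinner (t y' h) (t x g) = cinner (t y h) (t x' g)"
    using assms op_adjointD[of x x' A y y'] by (auto simp: cinner_t)
qed

lemma symmetric_B1: "B1 \<subseteq> op_adjoint B1"
  unfolding op_hilbert_tensor_def op_tensor_Id_left
proof (rule symmetric_closure_cspan, clarify, rule op_adjointI, clarify)
  fix x g g' y h h' assume "(g, g') \<in> B" "(h, h') \<in> B"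
  then show "cinner (t y h') (t x g) = cinner (t y h) (t x g')"
    using self_adjoint_operatorD(3)[OF B] op_adjointD[of g g' B h h'] by (auto simp: cinner_t)
qed

lemma csubspace_B1: "csubspace B1"
  unfolding op_hilbert_tensor_def op_tensor_Id_left by (rule csubspace_closure_cspan)

lemma op_tensor_subset_B1: "op_tensor t Id B \<subseteq> B1"
  unfolding op_hilbert_tensor_def by (rule closure_subset)

lemma ortho_complement_Domain_B1:
  assumes "y \<in> ortho_complement (Domain B1)"
  shows "y = 0"
proof (rule ortho_complement_tensors[OF t])
  show "cinner (t x g) y = 0" if "x \<in> UNIV" "g \<in> Domain B" for x g
    using that assms B1_mem' by (fastforce simp: ortho_complement_def)
qed (use self_adjoint_operatorD(4)[OF B] in auto)

lemma closure_Domain_B1: "closure (Domain B1) = UNIV"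
proof (rule closure_csubspace_eq_UNIV)
  show "csubspace (Domain B1)"
    unfolding Domain_fst by (intro csubspace_image csubspace_B1) (auto simp: scaleC_prod_def)
qed (rule ortho_complement_Domain_B1)

text \<open>Symmetry makes \<open>y\<close> orthogonal to the dense domain of
  \<open>B1\<close>.\<close>

lemma B1_single_valued: "(0, y) \<in> B1 \<Longrightarrow> y = 0"
  using symmetric_B1 op_adjointD[of 0 y B1]
  by (intro ortho_complement_Domain_B1) (fastforce simp: ortho_complement_def)

text \<open>Surjectivity of \<open>B + \<i> m\<close> puts all elementary tensors into the range of
  \<open>B1 + \<i> m\<close>, so only zero is orthogonal to it.\<close>

lemma B1_imaginary_surj:
  assumes "m \<noteq> 0"
  obtains h h' where "(h, h') \<in> B1" "h' + (\<i> * of_real m) *\<^sub>C h = g"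
proof (rule symmetric_imaginary_surj[OF csubspace_B1 _ symmetric_B1 assms])
  fix y assume y: "\<And>h h'. (h, h') \<in> B1 \<Longrightarrow> cinner (h' + (\<i> * of_real m) *\<^sub>C h) y = 0"
  show "y = 0"
  proof (rule ortho_complement_tensors[OF t])
    fix x g
    obtain h h' where h: "(h, h') \<in> B" "h' + (\<i> * of_real m) *\<^sub>C h = g"
      using self_adjoint_imaginary_surj[OF B assms] by blast
    have "t x g = t x h' + (\<i> * of_real m) *\<^sub>C t x h"
      by (simp add: h(2)[symmetric] t_simps)
    then show "cinner (t x g) y = 0"
      using y[OF B1_mem'[OF h(1)]] by simp
  qed (rule closure_UNIV)+
qed (auto simp: op_hilbert_tensor_def)

text \<open>
  The approximants are \<open>y = \<i>m (B1 + \<i>m)\<^sup>-\<^sup>1 \<psi>\<close> for large \<open>m\<close>; the resolvent acts on the second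
  tensor factor only, so it preserves the orthogonality relations.
\<close>

lemma regularization:
  assumes psi: "\<psi> \<in> ortho_complement (shifted_sums t c G B)"
  shows "\<psi> \<in> closure {y. \<exists>z. (y, z) \<in> B1 \<and> (y, - z - cnj c *\<^sub>C y) \<in> op_adjoint (op_hilbert_tensor t G Id)}"
  unfolding closure_approachable
proof (intro allI impI)
  fix e :: real assume "e > 0"
  then obtain u where "u \<in> Domain B1" "dist u \<psi> < e / 4"
    using closure_Domain_B1 closure_approachable[of \<psi> "Domain B1"] by (metis UNIV_I zero_less_divide_iff zero_less_numeral)
  then obtain u' where u: "(u, u') \<in> B1" "norm (\<psi> - u) < e / 4"
    by (auto simp: dist_norm norm_minus_commute)
  \<comment> \<open>Large enough for the error term \<open>u'\<close> to contribute at most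
    \<open>e / 4\<close> after division by \<open>m\<close>.\<close>
  define m where "m = 1 + 4 * norm u' / e"
  have m: "m > 0" "norm u' \<le> m * (e / 4)"
    using \<open>e > 0\<close> by (auto simp: m_def field_simps intro: add_pos_nonneg)
  obtain y z where yz: "(y, z) \<in> B1" "z + (\<i> * of_real m) *\<^sub>C y = (\<i> * of_real m) *\<^sub>C \<psi>"
    using B1_imaginary_surj[of m] m by (metis less_irrefl)
  have "dist y \<psi> < e"
  proof -
    have d: "(y - u, z - u') \<in> B1"
      using complex_vector.subspace_diff[OF csubspace_B1 yz(1) u(1)] by simp
    \<comment> \<open>The resolvent bound: \<open>B1 + \<i> m\<close> is bounded below by
      \<open>m\<close> and sends \<open>y - u\<close> to
      \<open>\<i> m (\<psi> - u) - u'\<close>.\<close>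
    have "(norm ((z - u') + (\<i> * of_real m) *\<^sub>C (y - u)))\<^sup>2 = (norm (z - u'))\<^sup>2 + m\<^sup>2 * (norm (y - u))\<^sup>2"
      by (rule norm_add_imaginary_sq) (rule op_adjointD[OF subsetD[OF symmetric_B1 d] d])
    then have "(m * norm (y - u))\<^sup>2 \<le> (norm ((z - u') + (\<i> * of_real m) *\<^sub>C (y - u)))\<^sup>2"
      by (simp add: power_mult_distrib)
    then have "m * norm (y - u) \<le> norm ((z - u') + (\<i> * of_real m) *\<^sub>C (y - u))"
      by (rule power2_le_imp_le) simp
    also have "(z - u') + (\<i> * of_real m) *\<^sub>C (y - u) = (\<i> * of_real m) *\<^sub>C (\<psi> - u) - u'"
      using yz(2) by (simp add: complex_vector.scale_right_diff_distrib algebra_simps)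
    also have "norm \<dots> \<le> m * norm (\<psi> - u) + norm u'"
      using norm_triangle_ineq4[of "(\<i> * of_real m) *\<^sub>C (\<psi> - u)" u'] m by (simp add: norm_scaleC norm_mult)
    also have "\<dots> \<le> m * (e / 4) + m * (e / 4)"
      using m u by (intro add_mono mult_left_mono) auto
    finally have "m * norm (y - u) \<le> m * (e / 2)"
      by (simp add: mult.commute)
    then have "norm (y - u) \<le> e / 2"
      using m by simp
    then have "norm (y - u) + norm (u - \<psi>) < e"
      using u(2) \<open>e > 0\<close> by (simp add: norm_minus_commute)
    then show ?thesis
      using norm_triangle_ineq[of "y - u" "u - \<psi>"] by (simp add: dist_norm)
  qed
  \<comment> \<open>Formally, the adjoint of \<open>G \<otimes> I\<close> plus
    \<open>B1 + cnj c\<close> annihilates \<open>y\<close>, which lies in the domains of both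
    summands.\<close>
  moreover have "(y, - z - cnj c *\<^sub>C y) \<in> op_adjoint (op_hilbert_tensor t G Id)"
    unfolding op_hilbert_tensor_def op_tensor_Id_right op_adjoint_closure_cspan
  proof (rule op_adjointI, clarify)
    \<comment> \<open>With \<open>h\<close> the resolvent
      \<open>(B - \<i> m)\<^sup>-\<^sup>1\<close> applied to \<open>g\<close>, pairing
      \<open>x \<otimes> g\<close> with \<open>y\<close> is \<open>\<i> m\<close> times pairing
      \<open>x \<otimes> h\<close> with \<open>\<psi>\<close>.\<close>
    have res: "cinner (t x (h' + (\<i> * of_real (- m)) *\<^sub>C h)) y = \<i> * of_real m * cinner (t x h) \<psi>"
      if "(h, h') \<in> B" for x h h'
    proof -
      have "cinner (t x (h' + (\<i> * of_real (- m)) *\<^sub>C h)) y = cinner (t x h) (z + (\<i> * of_real m) *\<^sub>C y)"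
        using op_adjointD[OF subsetD[OF symmetric_B1 yz(1)] B1_mem'[OF that], of x]
        by (simp add: t_simps t_diff_right cinner_simps)
      then show ?thesis
        by (simp add: yz(2) cinner_simps)
    qed
    fix x x' g assume x: "(x, x') \<in> G"
    have "cinner (t x' g) y + cinner (t x g) z + cinner (c *\<^sub>C t x g) y = 0" if g: "(g, g') \<in> B" for g g'
    proof -
      obtain h h' where h: "(h, h') \<in> B" "h' + (\<i> * of_real (- m)) *\<^sub>C h = g"
        using self_adjoint_imaginary_surj[OF B, of "- m"] m by (metis less_irrefl neg_equal_0_iff_equal)
      \<comment> \<open>The resolvent commutes with \<open>B\<close>: this pair says that
        \<open>h'\<close> is the resolvent applied to \<open>g'\<close>, so \<open>res\<close> also
        covers \<open>x \<otimes> g'\<close>.\<close>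
      have "(h', g' - (\<i> * of_real (- m)) *\<^sub>C h') \<in> B"
        using complex_vector.subspace_diff[OF self_adjoint_operatorD(1)[OF B] g
            complex_vector.subspace_scale[OF self_adjoint_operatorD(1)[OF B] h(1), of "\<i> * of_real (- m)"]]
        by (simp add: scaleC_prod_def h(2)[symmetric])
      note res' = res[OF this] and res = res[OF h(1)]
      have "cinner (t x g) z = cinner (t x g') y"
        using op_adjointD[OF subsetD[OF symmetric_B1 yz(1)] B1_mem'[OF g], of x] by simp
      then have "cinner (t x' g) y + cinner (t x g) z + cinner (c *\<^sub>C t x g) y
          = \<i> * of_real m * cinner (t x' h + t x h' + c *\<^sub>C t x h) \<psi>"
        using res[of x] res[of x'] res'[of x] unfolding h(2)
        by (simp add: cinner_simps algebra_simps)
      also have "\<dots> = 0"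
        using psi x h(1) unfolding mem_ortho_complement_shifted_sums by simp
      finally show ?thesis .
    qed
    then have zero: "cinner (t x' g) y + cinner (t x g) z + cinner (c *\<^sub>C t x g) y = 0" if "g \<in> Domain B" for g
      using that by blast
    \<comment> \<open>\<open>op_tensor t G Id\<close> admits arbitrary \<open>g\<close>, so the
      relation is extended from the dense domain of \<open>B\<close> by continuity.\<close>
    obtain s where s: "\<And>n. s n \<in> Domain B" "s \<longlonglongrightarrow> g"
      using self_adjoint_operatorD(4)[OF B] closure_sequential[of g "Domain B"] by auto
    have "(\<lambda>n. cinner (t x' (s n)) y + cinner (t x (s n)) z + cinner (c *\<^sub>C t x (s n)) y)
        \<longlonglongrightarrow> cinner (t x' g) y + cinner (t x g) z + cinner (c *\<^sub>C t x g) y"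
      by (intro tendsto_intros tendsto_cinner tendsto_scaleC tendsto_tensor[OF t] s) 
        (auto simp: complex_vector.subspace_UNIV)
    then have "cinner (t x' g) y + cinner (t x g) z + cinner (c *\<^sub>C t x g) y = 0"
      by (simp add: zero[OF s(1)] LIMSEQ_const_iff)
    then show "cinner (t x' g) y = cinner (t x g) (- z - cnj c *\<^sub>C y)"
      unfolding cinner_simps by algebra
  qed
  ultimately show "\<exists>y\<in>{y. \<exists>z. (y, z) \<in> B1 \<and> (y, - z - cnj c *\<^sub>C y) \<in> op_adjoint (op_hilbert_tensor t G Id)}.
      dist y \<psi> < e"
    using yz(1) by blast
qed

text \<open>The approximants from \<open>regularization\<close> can be moved across both summands,
  so they are orthogonal to the range of the sum; complements are closed, so their limit
  \<open>\<psi>\<close> is orthogonal as well, and continuity extends this to the closure of the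
  sum.\<close>

lemma ortho_complement_Range_closure:
  assumes A: "A \<subseteq> op_adjoint A"
  shows "ortho_complement (Range (op_add (closure (op_add (op_hilbert_tensor t A Id) B1)) (scalar_operator c)))
    = ortho_complement (shifted_sums t c A B)" (is "ortho_complement (Range (op_add (closure ?S) _)) = _")
proof
  have "kronecker_sum t A B \<subseteq> ?S"
    unfolding kronecker_sum_def op_add_def
    using A1_mem[of _ _ A] B1_mem' closure_subset[of "op_tensor t A Id"] by (fastforce simp: op_hilbert_tensor_def[of t A])
  then have "shifted_sums t c A B \<subseteq> Range (op_add (closure ?S) (scalar_operator c))"
    unfolding shifted_sums_def Range_op_add_scalar using closure_subset by blast
  then show "ortho_complement (Range (op_add (closure ?S) (scalar_operator c)))
      \<subseteq> ortho_complement (shifted_sums t c A B)"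
    by (rule ortho_complement_antimono)
next
  let ?p = "\<lambda>z :: 'c \<times> 'c. snd z + c *\<^sub>C fst z"
  have p: "bounded_linear ?p"
    by (intro bounded_linear_add bounded_linear_snd
        bounded_linear_compose[OF bounded_linear_scaleC bounded_linear_fst])
  show "ortho_complement (shifted_sums t c A B)
      \<subseteq> ortho_complement (Range (op_add (closure ?S) (scalar_operator c)))"
  proof
    fix \<psi> assume psi: "\<psi> \<in> ortho_complement (shifted_sums t c A B)"
    have "cinner (?p v) \<psi> = 0" if mem: "v \<in> ?S" for v
    proof -
      obtain f a b where v: "v = (f, a + b)" "(f, a) \<in> op_hilbert_tensor t A Id" "(f, b) \<in> B1"
        using mem by (auto simp: op_add_def)
      have "cinner (?p v) y = 0"
        if "(y, z) \<in> B1" "(y, - z - cnj c *\<^sub>C y) \<in> op_adjoint (op_hilbert_tensor t A Id)" for y z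
        using op_adjointD[OF that(2) v(2)] op_adjointD[OF subsetD[OF symmetric_B1 that(1)] v(3)]
        by (simp add: v(1) cinner_simps)
      then have "{y. \<exists>z. (y, z) \<in> B1 \<and> (y, - z - cnj c *\<^sub>C y) \<in> op_adjoint (op_hilbert_tensor t A Id)}
          \<subseteq> ortho_complement {?p v}"
        by (auto simp: ortho_complement_def)
      then have "\<psi> \<in> ortho_complement {?p v}"
        using closure_minimal[OF _ ortho_complement_closed] regularization[OF psi] by blast
      then show ?thesis
        by (simp add: ortho_complement_def)
    qed
    then have "?p ` ?S \<subseteq> ortho_complement {\<psi>}"
      by (subst subset_ortho_complement_commute) (auto simp: ortho_complement_def)
    then have "closure (?p ` ?S) \<subseteq> ortho_complement {\<psi>}"
      by (intro closure_minimal ortho_complement_closed)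
    then have "?p ` closure ?S \<subseteq> ortho_complement {\<psi>}"
      using closure_bounded_linear_image_subset[OF p, of ?S] by (rule order_trans[rotated])
    then have "{\<psi>} \<subseteq> ortho_complement (?p ` closure ?S)"
      by (subst subset_ortho_complement_commute)
    then show "\<psi> \<in> ortho_complement (Range (op_add (closure ?S) (scalar_operator c)))"
      by (simp add: Range_op_add_scalar)
  qed
qed

end

section \<open>Separable spaces\<close>

text \<open>For each point of a countable dense set and each radius \<open>1 / (n + 1)\<close>, one
  point of \<open>S\<close> within that radius is chosen if there is any.\<close>

lemma separable_space_subset:
  fixes S :: "'a :: metric_space set"
  assumes "separable_space (euclidean :: 'a topology)"
  obtains C where "countable C" "C \<subseteq> S" "S \<subseteq> closure C"
proof -
  obtain D :: "'a set" where D: "countable D" "closure D = UNIV"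
    using assms by (auto simp: separable_space_def)
  define P where "P z s \<longleftrightarrow> s \<in> S \<and> dist s (fst z) < inverse (Suc (snd z))" for z :: "'a \<times> nat" and s
  define C where "C = (\<lambda>z. SOME s. P z s) ` {z \<in> D \<times> UNIV. \<exists>s. P z s}"
  show ?thesis
  proof
    show "countable C"
      unfolding C_def by (intro countable_image countable_Collect countable_SIGMA D) auto
    have P: "P z (SOME s. P z s)" if "\<exists>s. P z s" for z
      using that by (rule someI_ex)
    then show "C \<subseteq> S"
      by (auto simp: C_def P_def)
    show "S \<subseteq> closure C"
    proof
      fix x assume "x \<in> S"
      show "x \<in> closure C"
        unfolding closure_approachable
      proof (intro allI impI)
        fix e :: real assume "e > 0"
        then obtain n where n: "inverse (Suc n) < e / 2"
          using reals_Archimedean half_gt_zero by blast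
        obtain d where d: "d \<in> D" "dist d x < inverse (Suc n)"
          using D(2) closure_approachable[of x D] by (metis UNIV_I inverse_positive_iff_positive of_nat_0_less_iff zero_less_Suc)
        then have "P (d, n) x"
          using \<open>x \<in> S\<close> by (simp add: P_def dist_commute)
        then have "(SOME s. P (d, n) s) \<in> C" "P (d, n) (SOME s. P (d, n) s)"
          using d P by (auto simp: C_def)
        moreover have "dist (SOME s. P (d, n) s) x < e"
          using calculation(2) d(2) n dist_triangle[of "SOME s. P (d, n) s" x d] by (auto simp: P_def)
        ultimately show "\<exists>y\<in>C. dist y x < e"
          by blast
      qed
    qed
  qed
qed

lemma separable_space_prod:
  assumes "separable_space (euclidean :: 'a :: topological_space topology)"
    and "separable_space (euclidean :: 'b :: topological_space topology)"
  shows "separable_space (euclidean :: ('a \<times> 'b) topology)"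
proof -
  obtain C :: "'a set" and D :: "'b set" where "countable C" "closure C = UNIV" "countable D" "closure D = UNIV"
    using assms by (auto simp: separable_space_def)
  then show ?thesis
    unfolding separable_space_def by (intro exI[of _ "C \<times> D"]) (auto simp: closure_Times)
qed

section \<open>The deficiency spaces\<close>

text \<open>
  This is the restriction of the adjoint of \<open>A\<close> to \<open>\<D>(A) + \<N>\<^sub>+(A)\<close>. It is dissipative, and its
  closure is maximal dissipative.
\<close>

definition deficiency_extension :: "('a :: complex_hilbert_space, 'a) operator \<Rightarrow> ('a, 'a) operator" where
  "deficiency_extension A = {(x + h, x' + \<i> *\<^sub>C h) | x x' h. (x, x') \<in> A \<and> h \<in> deficiency_plus A}"

lemma csubspace_deficiency_plus: "csubspace (deficiency_plus A)"
  unfolding deficiency_plus_def by (rule ortho_complement_csubspace)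

locale tensor_symmetric_self_adjoint = tensor_self_adjoint t B
  for t :: "'a :: complex_hilbert_space \<Rightarrow> 'b :: complex_hilbert_space \<Rightarrow> 'c :: complex_hilbert_space"
    and B :: "('b, 'b) operator" +
  fixes A :: "('a, 'a) operator"
  assumes A: "symmetric_operator A"
begin

abbreviation N where "N \<equiv> deficiency_plus A"
abbreviation A' where "A' \<equiv> deficiency_extension A"

lemma A_zero: "(0, 0) \<in> A"
  using complex_vector.subspace_0[OF symmetric_operatorD(1)[OF A]] by (simp add: zero_prod_def)

lemma N_zero: "0 \<in> N"
  by (rule complex_vector.subspace_0[OF csubspace_deficiency_plus])

lemma extension_mem: "(x, x') \<in> A \<Longrightarrow> h \<in> N \<Longrightarrow> (x + h, x' + \<i> *\<^sub>C h) \<in> A'"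
  by (auto simp: deficiency_extension_def)

lemma N_extension: "h \<in> N \<Longrightarrow> (h, \<i> *\<^sub>C h) \<in> A'"
  using extension_mem[OF A_zero] by simp

lemma cinner_N: "h \<in> N \<Longrightarrow> (x, x') \<in> A \<Longrightarrow> cinner x' h = \<i> * cinner x h"
  using op_adjointD[of h "\<i> *\<^sub>C h" A x x'] by (simp add: mem_deficiency_plus_iff_adjoint cinner_simps)

text \<open>Each \<open>f\<close> splits as \<open>x + p\<close> with \<open>x\<close> from
  \<open>A \<otimes> I\<close> and \<open>p\<close> from tensors over \<open>N\<close>, on which the
  adjoint acts as \<open>\<i>\<close>. Symmetry removes \<open>x\<close> and the cross terms from
  the imaginary part, leaving \<open>(norm p)\<^sup>2\<close>.\<close>

lemma dissipative_tensor_extension: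
  assumes "(f, f') \<in> op_tensor t A' Id"
  shows "0 \<le> Im (cinner f f')"
proof -
  let ?S = "op_tensor t A Id" and ?K = "cspan {(t h g, \<i> *\<^sub>C t h g) | h g. h \<in> N}"
  have S: "?S \<subseteq> op_adjoint ?S"
    using symmetric_A1[OF symmetric_operatorD(2)[OF A]] closure_subset[of ?S]
    unfolding op_hilbert_tensor_def op_tensor_Id_right op_adjoint_closure_cspan op_adjoint_cspan by blast
  have "?K \<subseteq> op_adjoint ?S"
    unfolding op_tensor_Id_right op_adjoint_cspan
    by (intro complex_vector.span_minimal csubspace_op_adjoint)
      (auto intro!: op_adjointI simp: cinner_t cinner_simps cinner_N)
  moreover have "csubspace {z :: 'c \<times> 'c. snd z = \<i> *\<^sub>C fst z}"
    by (rule complex_vector.subspaceI) (auto simp: scaleC_prod_def scaleC_add_right scaleC_scaleC_commute[of \<i>])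
  then have "?K \<subseteq> {z. snd z = \<i> *\<^sub>C fst z}"
    by (intro complex_vector.span_minimal) auto
  ultimately have K: "k \<in> ?K \<Longrightarrow> k = (fst k, \<i> *\<^sub>C fst k) \<and> (fst k, \<i> *\<^sub>C fst k) \<in> op_adjoint ?S" for k
    by (metis (mono_tags, lifting) mem_Collect_eq prod.collapse subsetD)
  have "op_tensor t A' Id \<subseteq> {s + k | s k. s \<in> ?S \<and> k \<in> ?K}"
  proof -
    have "(t y g, t y' g) \<in> {s + k | s k. s \<in> ?S \<and> k \<in> ?K}" if mem: "(y, y') \<in> A'" for y y' g
    proof -
      obtain x x' h where *: "y = x + h" "y' = x' + \<i> *\<^sub>C h" "(x, x') \<in> A" "h \<in> N"
        using mem by (auto simp: deficiency_extension_def)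
      have "(t y g, t y' g) = (t x g, t x' g) + (t h g, \<i> *\<^sub>C t h g)"
        by (simp add: * t_simps)
      moreover have "(t h g, \<i> *\<^sub>C t h g) \<in> ?K"
        using * by (intro complex_vector.span_base) auto
      ultimately show ?thesis
        using A1_mem[OF *(3), of g] by blast
    qed
    moreover have "csubspace {s + k | s k. s \<in> ?S \<and> k \<in> ?K}"
      unfolding op_tensor_Id_right
      by (intro complex_vector.subspace_sums complex_vector.subspace_span)
    ultimately show ?thesis
      unfolding op_tensor_Id_right[of t A'] by (intro complex_vector.span_minimal) auto
  qed
  then obtain s k where sk: "(f, f') = s + k" "s \<in> ?S" "k \<in> ?K"
    using assms by blast
  obtain x x' where s: "s = (x, x')"
    by (cases s)
  define p where "p = fst k"
  have k: "k = (p, \<i> *\<^sub>C p)" "(p, \<i> *\<^sub>C p) \<in> op_adjoint ?S"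
    using K[OF sk(3)] by (auto simp: p_def)
  have f: "f = x + p" "f' = x' + \<i> *\<^sub>C p"
    using sk(1) s k by auto
  have 1: "cinner x' p = cinner x (\<i> *\<^sub>C p)"
    using op_adjointD[OF k(2)] sk(2) s by blast
  have 2: "Im (cinner x x') = 0"
    using cinner_symmetric_real[OF S] sk(2) s by blast
  have 3: "cinner p x' = cnj (cinner x (\<i> *\<^sub>C p))"
    using 1 cinner_commute[of p x'] by simp
  show ?thesis
    using 2 by (simp add: f cinner_add_left cinner_add_right 3) (simp add: cinner_simps cinner_self)
qed

lemma kronecker_sum_subset: "cspan (kronecker_sum t G B) \<subseteq> op_add (op_tensor t G Id) (op_tensor t Id B)"
proof (rule complex_vector.span_minimal)
  show "kronecker_sum t G B \<subseteq> op_add (op_tensor t G Id) (op_tensor t Id B)"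
    unfolding kronecker_sum_def op_add_def using A1_mem[of _ _ G] B1_mem by fastforce
  show "csubspace (op_add (op_tensor t G Id) (op_tensor t Id B))"
    unfolding op_tensor_Id_left op_tensor_Id_right
    by (intro csubspace_op_add complex_vector.subspace_span)
qed

text \<open>The summand from \<open>B\<close> contributes nothing imaginary and the one from
  \<open>A'\<close> nothing negative, while the shift by \<open>\<i>\<close> adds
  \<open>(norm f)\<^sup>2\<close>; Cauchy-Schwarz gives the bound.\<close>

lemma norm_le_kronecker_sum_extension:
  assumes "(f, f') \<in> cspan (kronecker_sum t A' B)"
  shows "norm f \<le> norm (f' + \<i> *\<^sub>C f)"
proof -
  obtain a b where ab: "f' = a + b" "(f, a) \<in> op_tensor t A' Id" "(f, b) \<in> op_tensor t Id B"
    using assms kronecker_sum_subset[of A'] by (auto simp: op_add_def)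
  have "Im (cinner f b) = 0"
    using cinner_symmetric_real[OF symmetric_B1] ab(3) op_tensor_subset_B1 by blast
  then have "0 \<le> Im (cinner f f')"
    using dissipative_tensor_extension[OF ab(2)] by (simp add: ab(1) cinner_simps)
  then have "(norm f)\<^sup>2 \<le> Im (cinner f (f' + \<i> *\<^sub>C f))"
    by (simp add: cinner_simps cinner_self)
  also have "\<dots> \<le> norm f * norm (f' + \<i> *\<^sub>C f)"
    using abs_Im_le_cmod[of "cinner f (f' + \<i> *\<^sub>C f)"] norm_cinner_le[of f "f' + \<i> *\<^sub>C f"] by linarith
  finally show ?thesis
    by (cases "f = 0") (simp_all add: power2_eq_square)
qed

text \<open>Regularization reduces the claim to a \<open>y\<close> in the domains of both summands;
  there the adjoint of the dissipative \<open>A' \<otimes> I\<close> would produce an imaginary part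
  of the wrong sign unless \<open>y = 0\<close>.\<close>

lemma ortho_complement_extension:
  assumes psi: "\<psi> \<in> ortho_complement (shifted_sums t \<i> A' B)"
  shows "\<psi> = 0"
proof -
  let ?p = "\<lambda>z :: 'a \<times> 'a. snd z + \<i> *\<^sub>C fst z" and ?q = "\<lambda>z :: 'c \<times> 'c. snd z + \<i> *\<^sub>C fst z"
  have "csubspace ((\<lambda>h. (h, \<i> *\<^sub>C h)) ` N)"
    by (intro csubspace_image csubspace_deficiency_plus)
      (auto simp: scaleC_prod_def scaleC_add_right scaleC_scaleC_commute[of \<i>])
  then have "csubspace {x + y | x y. x \<in> A \<and> y \<in> (\<lambda>h. (h, \<i> *\<^sub>C h)) ` N}"
    by (intro complex_vector.subspace_sums symmetric_operatorD(1)[OF A])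
  also have "{x + y | x y. x \<in> A \<and> y \<in> (\<lambda>h. (h, \<i> *\<^sub>C h)) ` N} = A'"
    by (force simp: deficiency_extension_def)
  finally have A': "csubspace A'" .
  \<comment> \<open>A vector orthogonal to the range lies in \<open>N\<close> because
    \<open>A'\<close> extends \<open>A\<close>; on \<open>N\<close> the operator
    \<open>A' + \<i>\<close> is multiplication by \<open>2 * \<i>\<close>, so the vector is
    orthogonal to itself.\<close>
  have dense: "closure (?p ` A') = UNIV"
  proof (rule closure_csubspace_eq_UNIV)
    show "csubspace (?p ` A')"
      by (intro csubspace_image A' snd_add_scaleC_fst_linear)
    fix y assume y: "y \<in> ortho_complement (?p ` A')"
    have "(x, x') \<in> A'" if "(x, x') \<in> A" for x x'
      using extension_mem[OF that N_zero] by simp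
    then have "y \<in> N"
      using y by (force simp: mem_deficiency_plus ortho_complement_def)
    have "cinner (\<i> *\<^sub>C y + \<i> *\<^sub>C y) y = 0"
      using y N_extension[OF \<open>y \<in> N\<close>] by (force simp: ortho_complement_def)
    then show "y = 0"
      by (simp add: cinner_simps)
  qed
  have dense1: "closure (?q ` op_tensor t A' Id) = UNIV"
  proof (rule closure_csubspace_eq_UNIV)
    show "csubspace (?q ` op_tensor t A' Id)"
      unfolding op_tensor_Id_right
      by (intro csubspace_image complex_vector.subspace_span snd_add_scaleC_fst_linear)
    fix y assume y: "y \<in> ortho_complement (?q ` op_tensor t A' Id)"
    show "y = 0"
    proof (rule ortho_complement_tensors[OF t dense closure_UNIV])
      fix x g assume "x \<in> ?p ` A'"
      then obtain u u' where u: "(u, u') \<in> A'" "x = u' + \<i> *\<^sub>C u"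
        by auto
      then have "t x g \<in> ?q ` op_tensor t A' Id"
        using A1_mem[OF u(1), of g] by (force simp: t_simps)
      then show "cinner (t x g) y = 0"
        using y unfolding ortho_complement_def by blast
    qed
  qed
  have "y = 0" if yz: "(y, z) \<in> B1" "(y, - z - cnj \<i> *\<^sub>C y) \<in> op_adjoint (op_hilbert_tensor t A' Id)" for y z
  proof -
    have "(y, - z - cnj \<i> *\<^sub>C y) \<in> op_adjoint (op_tensor t A' Id)"
      using yz(2) unfolding op_hilbert_tensor_def op_tensor_Id_right op_adjoint_closure_cspan op_adjoint_cspan .
    moreover have "closure {x' + \<i> *\<^sub>C x | x x'. (x, x') \<in> op_tensor t A' Id} = UNIV"
    proof -
      have "{x' + \<i> *\<^sub>C x | x x'. (x, x') \<in> op_tensor t A' Id} = ?q ` op_tensor t A' Id"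
        by force
      then show ?thesis
        using dense1 by simp
    qed
    \<comment> \<open>This imaginary part also equals \<open>(norm y)\<^sup>2\<close>, since
      \<open>- cnj \<i> = \<i>\<close> and \<open>z\<close> contributes nothing.\<close>
    ultimately have "Im (cinner y (- z - cnj \<i> *\<^sub>C y)) \<le> 0"
      by (intro adjoint_dissipative[OF dissipative_tensor_extension])
    moreover have "Im (cinner y z) = 0"
      by (rule cinner_symmetric_real[OF symmetric_B1 yz(1)])
    ultimately show ?thesis
      by (simp add: cinner_simps cinner_self)
  qed
  then have "{y. \<exists>z. (y, z) \<in> B1 \<and> (y, - z - cnj \<i> *\<^sub>C y) \<in> op_adjoint (op_hilbert_tensor t A' Id)} \<subseteq> {0}"
    by blast
  then show ?thesis
    by (rule in_closure_subset_zero[OF regularization[OF psi]])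
qed

section \<open>From tensors over \<open>N\<close> to the deficiency space\<close>

text \<open>The graph of \<open>\<i> + I \<otimes> B\<close> on elementary tensors over
  \<open>N\<close>. Since the adjoint of \<open>A\<close> acts there as \<open>\<i>\<close>, it is
  part of both \<open>A' \<otimes> I + I \<otimes> B\<close> and the adjoint of
  \<open>A \<otimes> I + I \<otimes> B\<close>.\<close>

definition deficiency_graph :: "('c \<times> 'c) set" where
  "deficiency_graph = {(t h g, t h (\<i> *\<^sub>C g + g')) | h g g'. h \<in> N \<and> (g, g') \<in> B}"

lemma deficiency_graph_B:
  assumes "(p, v) \<in> cspan deficiency_graph"
  shows "(p, v - \<i> *\<^sub>C p) \<in> B1"
proof -
  let ?L = "\<lambda>z :: 'c \<times> 'c. (fst z, snd z + \<i> *\<^sub>C fst z)"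
  have "cspan deficiency_graph \<subseteq> cspan (?L ` {(t x g, t x g') | x g g'. (g, g') \<in> B})"
    by (intro complex_vector.span_mono) (force simp: deficiency_graph_def t_simps add.commute)
  also have "\<dots> = ?L ` op_tensor t Id B"
    unfolding op_tensor_Id_left
    by (rule cspan_image[symmetric]) (auto simp: scaleC_prod_def scaleC_add_right scaleC_scaleC_commute[of \<i>])
  finally obtain z where "z \<in> op_tensor t Id B" "(p, v) = ?L z"
    using assms by blast
  then have "(p, v - \<i> *\<^sub>C p) \<in> op_tensor t Id B"
    by (cases z) auto
  then show ?thesis
    using op_tensor_subset_B1 by blast
qed

lemma deficiency_graph_zero: "(0, v) \<in> cspan deficiency_graph \<Longrightarrow> v = 0"
  using deficiency_graph_B[of 0 v] B1_single_valued by simp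

lemma deficiency_graph_kronecker_sum: "cspan deficiency_graph \<subseteq> cspan (kronecker_sum t A' B)"
proof (intro complex_vector.span_mono subsetI)
  fix z assume "z \<in> deficiency_graph"
  then obtain h g g' where z: "z = (t h g, t h (\<i> *\<^sub>C g + g'))" "h \<in> N" "(g, g') \<in> B"
    by (auto simp: deficiency_graph_def)
  have "t h (\<i> *\<^sub>C g + g') = t (\<i> *\<^sub>C h) g + t h g'"
    by (simp add: t_simps)
  then show "z \<in> kronecker_sum t A' B"
    unfolding kronecker_sum_def using z N_extension[OF z(2)] by blast
qed

lemma deficiency_graph_adjoint: "cspan deficiency_graph \<subseteq> op_adjoint (cspan (kronecker_sum t A B))"
  unfolding op_adjoint_cspan
proof (intro complex_vector.span_minimal csubspace_op_adjoint, clarify)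
  fix y z assume "(y, z) \<in> deficiency_graph"
  then obtain h g g' where z: "y = t h g" "z = t h (\<i> *\<^sub>C g + g')" "h \<in> N" "(g, g') \<in> B"
    by (auto simp: deficiency_graph_def)
  show "(y, z) \<in> op_adjoint (kronecker_sum t A B)"
  proof (rule op_adjointI)
    fix v w assume "(v, w) \<in> kronecker_sum t A B"
    then obtain x x' k k' where *: "v = t x k" "w = t x' k + t x k'" "(x, x') \<in> A" "(k, k') \<in> B"
      by (auto simp: kronecker_sum_def)
    have "cinner k' g = cinner k g'"
      using self_adjoint_operatorD(3)[OF B] op_adjointD[of g g' B k k'] z(4) *(4) by blast
    then show "cinner w y = cinner v z"
      by (simp add: * z(1,2) cinner_t cinner_simps t_simps cinner_N[OF z(3) *(3)])
  qed
qed

text \<open>If \<open>v + \<i> *\<^sub>C p\<close> is a limit of values of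
  \<open>A \<otimes> I + I \<otimes> B + \<i>\<close>, the lower bound makes the arguments converge
  to \<open>p\<close>. The adjoint relation then shows in the limit that \<open>cinner p v\<close>
  is real, whereas \<open>v = \<i> p + B1 p\<close> gives it the imaginary part
  \<open>(norm p)\<^sup>2\<close>.\<close>

lemma deficiency_graph_range:
  assumes pv: "(p, v) \<in> cspan deficiency_graph"
    and mem: "v + \<i> *\<^sub>C p \<in> closure (cspan (shifted_sums t \<i> A B))"
  shows "p = 0"
proof -
  let ?q = "\<lambda>z :: 'c \<times> 'c. snd z + \<i> *\<^sub>C fst z"
  have "cspan (shifted_sums t \<i> A B) = ?q ` cspan (kronecker_sum t A B)"
    unfolding shifted_sums_def by (rule cspan_image[symmetric]) (rule snd_add_scaleC_fst_linear)+
  then obtain u where u: "\<And>n. u n \<in> ?q ` cspan (kronecker_sum t A B)" "u \<longlonglongrightarrow> v + \<i> *\<^sub>C p"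
    using mem closure_sequential[of "v + \<i> *\<^sub>C p"] by auto
  then have "\<exists>z. z \<in> cspan (kronecker_sum t A B) \<and> u n = ?q z" for n
    by blast
  then obtain z where z: "\<And>n. z n \<in> cspan (kronecker_sum t A B)" "\<And>n. u n = ?q (z n)"
    by metis
  have "kronecker_sum t A B \<subseteq> kronecker_sum t A' B"
    using extension_mem[OF _ N_zero] by (fastforce simp: kronecker_sum_def)
  then have sub: "cspan (kronecker_sum t A B) \<subseteq> cspan (kronecker_sum t A' B)"
    by (rule complex_vector.span_mono)
  \<comment> \<open>Approximants and \<open>(p, v)\<close> all lie in the graph of the extension, so
    its lower bound applies to their difference.\<close>
  have "norm (fst (z n) - p) \<le> norm (u n - (v + \<i> *\<^sub>C p))" for n
  proof -
    have "z n - (p, v) \<in> cspan (kronecker_sum t A' B)"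
      using z(1)[of n] sub pv deficiency_graph_kronecker_sum by (intro complex_vector.span_diff) auto
    then have "(fst (z n) - p, snd (z n) - v) \<in> cspan (kronecker_sum t A' B)"
      by (cases "z n") simp
    from norm_le_kronecker_sum_extension[OF this] show ?thesis
      by (simp add: z(2) complex_vector.scale_right_diff_distrib algebra_simps)
  qed
  from Lim_null_comparison[OF always_eventually[OF allI, OF this] tendsto_norm_zero[OF LIM_zero[OF u(2)]]]
  have lim: "(\<lambda>n. fst (z n)) \<longlonglongrightarrow> p"
    by (rule LIM_zero_cancel)
  have "cinner (u n) p = cinner (fst (z n)) v - \<i> * cinner (fst (z n)) p" for n
  proof -
    have "(p, v) \<in> op_adjoint (cspan (kronecker_sum t A B))"
      using pv deficiency_graph_adjoint by blast
    from op_adjointD[OF this, of "fst (z n)" "snd (z n)"] z(1)[of n] show ?thesis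
      by (simp add: z(2) cinner_simps)
  qed
  moreover have "(\<lambda>n. cinner (u n) p) \<longlonglongrightarrow> cinner (v + \<i> *\<^sub>C p) p"
    by (intro tendsto_cinner u tendsto_const)
  moreover have "(\<lambda>n. cinner (fst (z n)) v - \<i> * cinner (fst (z n)) p) \<longlonglongrightarrow> cinner p v - \<i> * cinner p p"
    by (intro tendsto_intros tendsto_cinner lim)
  ultimately have "cinner (v + \<i> *\<^sub>C p) p = cinner p v - \<i> * cinner p p"
    by (simp add: LIMSEQ_unique)
  then have "cinner v p = cinner p v"
    by (simp add: cinner_simps)
  moreover have "cinner (v - \<i> *\<^sub>C p) p = cinner p (v - \<i> *\<^sub>C p)"
    using op_adjointD[OF subsetD[OF symmetric_B1]] deficiency_graph_B[OF pv] by blast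
  ultimately show ?thesis
    by (simp add: cinner_simps)
qed

lemma isometrically_isomorphic_deficiency:
  fixes T_plus :: "'d :: complex_hilbert_space set" and t' :: "'a \<Rightarrow> 'b \<Rightarrow> 'd"
  assumes sep: "separable_space (euclidean :: 'a topology)" "separable_space (euclidean :: 'b topology)"
    and t': "is_hilbert_tensor N UNIV T_plus t'"
  shows "isometrically_isomorphic (ortho_complement (shifted_sums t \<i> A B)) T_plus"
proof -
  let ?M = "ortho_complement (shifted_sums t \<i> A B)"
  obtain X where X: "countable X" "X \<subseteq> N" "N \<subseteq> closure X"
    using separable_space_subset[OF sep(1)] by metis
  \<comment> \<open>Density is taken in the graph of \<open>B\<close>, so that approximation
    controls \<open>g\<close> and \<open>B g\<close> simultaneously.\<close>
  obtain Y where Y: "countable Y" "Y \<subseteq> B" "B \<subseteq> closure Y"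
    using separable_space_subset[OF separable_space_prod[OF sep(2,2)]] by metis
  have "X \<times> Y \<noteq> {}" "countable (X \<times> Y)"
    using X Y N_zero complex_vector.subspace_0[OF self_adjoint_operatorD(1)[OF B]] by auto
  define s where "s = from_nat_into (X \<times> Y)"
  have s: "range s = X \<times> Y"
    unfolding s_def by (rule range_from_nat_into) fact+
  define h g g' where "h n = fst (s n)" and "g n = fst (snd (s n))" and "g' n = snd (snd (s n))" for n
  have "s n \<in> X \<times> Y" for n
    using s by blast
  then have h: "h n \<in> N" and g: "(g n, g' n) \<in> B" for n
    using X(2) Y(2) by (auto simp: h_def g_def g'_def mem_Times_iff)
  have ex: "\<exists>n. h n = x \<and> g n = y \<and> g' n = y'" if "x \<in> X" "(y, y') \<in> Y" for x y y'
  proof -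
    have "(x, y, y') \<in> range s"
      using s that by auto
    then show ?thesis
      by (auto simp: h_def g_def g'_def) (metis fst_conv snd_conv)
  qed
  have M: "csubspace ?M" "closed ?M"
    by (rule ortho_complement_csubspace, rule ortho_complement_closed)
  \<comment> \<open>\<open>u n\<close> is \<open>2 \<i> + I \<otimes> B\<close> applied to
    \<open>h n \<otimes> g n\<close>; below, \<open>w n\<close> is its projection onto
    \<open>?M\<close>.\<close>
  define u where "u n = t (h n) (\<i> *\<^sub>C g n + g' n) + \<i> *\<^sub>C t (h n) (g n)" for n
  have "\<forall>n. \<exists>p. p \<in> ?M \<and> u n - p \<in> ortho_complement ?M"
    using projection_ex[OF M] by blast
  from choice[OF this] obtain w
    where w: "\<And>n. w n \<in> ?M" "\<And>n. u n - w n \<in> ortho_complement ?M"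
    by blast
  let ?v = "\<lambda>n. t (h n) (g n)"
  have "isometrically_isomorphic (closure (cspan (range w))) (closure (cspan (range ?v)))"
  proof (rule isometrically_isomorphic_injective_spans)
    fix y x assume yx: "(y, x) \<in> cspan (range (\<lambda>n. (w n, ?v n)))"
    \<comment> \<open>Pairs in which \<open>y\<close> is the projection onto \<open>?M\<close> of
      \<open>v + \<i> *\<^sub>C x\<close>; as a subspace containing the generating pairs,
      \<open>V\<close> contains their span.\<close>
    define V where "V = {(y, x). \<exists>v. (x, v) \<in> cspan deficiency_graph \<and> y \<in> ?M
      \<and> v + \<i> *\<^sub>C x - y \<in> ortho_complement ?M}"
    have "csubspace V"
    proof (rule complex_vector.subspaceI)
      show "0 \<in> V"
        using complex_vector.span_zero[of deficiency_graph] complex_vector.subspace_0[OF M(1)]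
          complex_vector.subspace_0[OF ortho_complement_csubspace[of ?M]]
        by (auto simp: V_def zero_prod_def intro!: exI[of _ 0])
    next
      fix p q assume "p \<in> V" "q \<in> V"
      then obtain y x v y' x' v' where *: "p = (y, x)" "q = (y', x')"
          "(x, v) \<in> cspan deficiency_graph" "(x', v') \<in> cspan deficiency_graph" "y \<in> ?M" "y' \<in> ?M"
          "v + \<i> *\<^sub>C x - y \<in> ortho_complement ?M" "v' + \<i> *\<^sub>C x' - y' \<in> ortho_complement ?M"
        unfolding V_def by blast
      have "(x + x', v + v') \<in> cspan deficiency_graph"
        using complex_vector.span_add[OF *(3,4)] by simp
      moreover have "y + y' \<in> ?M"
        by (rule complex_vector.subspace_add[OF M(1) *(5,6)])
      moreover have "(v + v') + \<i> *\<^sub>C (x + x') - (y + y') \<in> ortho_complement ?M"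
        using complex_vector.subspace_add[OF ortho_complement_csubspace *(7,8)]
        by (simp add: scaleC_add_right algebra_simps)
      ultimately show "p + q \<in> V"
        unfolding V_def * by auto
    next
      fix c p assume "p \<in> V"
      then obtain y x v where *: "p = (y, x)" "(x, v) \<in> cspan deficiency_graph" "y \<in> ?M"
          "v + \<i> *\<^sub>C x - y \<in> ortho_complement ?M"
        unfolding V_def by blast
      have "(c *\<^sub>C x, c *\<^sub>C v) \<in> cspan deficiency_graph"
        using complex_vector.span_scale[OF *(2), of c] by (simp add: scaleC_prod_def)
      moreover have "c *\<^sub>C y \<in> ?M"
        by (rule complex_vector.subspace_scale[OF M(1) *(3)])
      moreover have "c *\<^sub>C v + \<i> *\<^sub>C c *\<^sub>C x - c *\<^sub>C y \<in> ortho_complement ?M"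
        using complex_vector.subspace_scale[OF ortho_complement_csubspace *(4), of c]
        by (simp add: scaleC_add_right complex_vector.scale_right_diff_distrib mult.commute)
      ultimately show "c *\<^sub>C p \<in> V"
        unfolding V_def * scaleC_prod_def by auto
    qed
    moreover have "(w n, ?v n) \<in> V" for n
    proof -
      have "(?v n, t (h n) (\<i> *\<^sub>C g n + g' n)) \<in> cspan deficiency_graph"
        using h[of n] g[of n] by (intro complex_vector.span_base) (auto simp: deficiency_graph_def)
      then show ?thesis
        using w[of n] by (auto simp: V_def u_def)
    qed
    ultimately have "cspan (range (\<lambda>n. (w n, ?v n))) \<subseteq> V"
      by (intro complex_vector.span_minimal) auto
    then have "(y, x) \<in> V"
      using yx by blast
    then obtain v where v: "(x, v) \<in> cspan deficiency_graph" "y \<in> ?M" "v + \<i> *\<^sub>C x - y \<in> ortho_complement ?M"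
      by (auto simp: V_def)
    show "y = 0 \<longleftrightarrow> x = 0"
    proof
      assume "y = 0"
      \<comment> \<open>With \<open>y = 0\<close> the vector \<open>v + \<i> *\<^sub>C x\<close> is
        orthogonal to \<open>?M\<close>, so it lies in the closed span of the shifted sums and
        \<open>deficiency_graph_range\<close> applies.\<close>
      moreover have "ortho_complement ?M = closure (cspan (shifted_sums t \<i> A B))"
        by (subst ortho_complement_closure_cspan[symmetric],
            subst ortho_complement_ortho_complement[OF csubspace_closure_cspan]) simp
      ultimately show "x = 0"
        using deficiency_graph_range[OF v(1)] v(3) by simp
    next
      assume "x = 0"
      then have "v = 0"
        using deficiency_graph_zero v(1) by simp
      then have "- y \<in> ortho_complement ?M"
        using v(3) \<open>x = 0\<close> by simp
      then have "cinner y (- y) = 0"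
        using v(2) unfolding ortho_complement_def by blast
      then show "y = 0"
        by (simp add: cinner_simps)
    qed
  qed
  then have "isometrically_isomorphic (closure (cspan (range w)))
      (closure (cspan (range (\<lambda>n. t' (h n) (g n)))))"
  proof (rule isometrically_isomorphic_trans)
    \<comment> \<open>Both families have the Gram matrix
      \<open>cinner (h i) (h j) * cinner (g i) (g j)\<close>.\<close>
    show "isometrically_isomorphic (closure (cspan (range ?v)))
        (closure (cspan (range (\<lambda>n. t' (h n) (g n)))))"
      using h by (intro isometrically_isomorphic_spans) (simp add: cinner_t cinner_tensor[OF t'])
  qed
  also have "closure (cspan (range (\<lambda>n. t' (h n) (g n)))) = T_plus"
  proof
    have "cspan (range (\<lambda>n. t' (h n) (g n))) \<subseteq> cspan {t' x y | x y. x \<in> N}"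
      using h by (intro complex_vector.span_mono) auto
    then show "closure (cspan (range (\<lambda>n. t' (h n) (g n)))) \<subseteq> T_plus"
      unfolding closure_cspan_tensor[OF t', symmetric] by (rule closure_mono)
    have "t' x y \<in> closure (cspan (range (\<lambda>n. t' (h n) (g n))))" if "x \<in> N" for x y
    proof -
      have "fst ` B \<subseteq> closure (fst ` Y)"
        using image_mono[OF Y(3), of fst] closure_bounded_linear_image_subset[OF bounded_linear_fst, of Y] by blast
      then have "closure (Domain B) \<subseteq> closure (fst ` Y)"
        unfolding Domain_fst by (rule closure_minimal) simp
      then have "t' x y \<in> closure {t' x y | x y. x \<in> X \<and> y \<in> fst ` Y}"
        using that X self_adjoint_operatorD(4)[OF B]
        by (intro tensor_mem_closure[OF t' csubspace_deficiency_plus]) auto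
      also have "\<dots> \<subseteq> closure (cspan (range (\<lambda>n. t' (h n) (g n))))"
      proof (rule closure_mono, clarify)
        fix x y y' assume "x \<in> X" "(y, y') \<in> Y"
        then obtain n where "h n = x" "g n = y"
          using ex by blast
        then show "t' x (fst (y, y')) \<in> cspan (range (\<lambda>n. t' (h n) (g n)))"
          by (auto intro!: complex_vector.span_base)
      qed
      finally show ?thesis .
    qed
    then show "T_plus \<subseteq> closure (cspan (range (\<lambda>n. t' (h n) (g n))))"
      unfolding closure_cspan_tensor[OF t', symmetric]
      by (intro closure_cspan_minimal csubspace_closure_cspan) auto
  qed
  finally have "isometrically_isomorphic (closure (cspan (range w))) T_plus" .
  moreover have "closure (cspan (range w)) = ?M"
  proof (rule closed_csubspace_eqI[OF csubspace_closure_cspan closed_closure M(1)])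
    show "closure (cspan (range w)) \<subseteq> ?M"
      using w by (intro closure_cspan_minimal M) auto
    fix y assume "y \<in> ?M" and y: "y \<in> ortho_complement (closure (cspan (range w)))"
    \<comment> \<open>\<open>u n\<close> and \<open>w n\<close> differ by a vector orthogonal to
      \<open>?M\<close>, so they have the same inner product with \<open>y\<close>.\<close>
    have zero: "cinner (u n) y = 0" for n
    proof -
      have "cinner (w n) y = 0"
        using y unfolding ortho_complement_closure_cspan by (simp add: ortho_complement_def)
      moreover have "cinner y (u n - w n) = 0"
        using w(2)[of n] \<open>y \<in> ?M\<close> unfolding ortho_complement_def by blast
      then have "cinner (u n - w n) y = 0"
        by (simp add: cinner_eq_0_commute)
      ultimately show ?thesis
        by (simp add: cinner_simps)
    qed
    \<comment> \<open>Joint continuity of \<open>t\<close> extends \<open>zero\<close> from the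
      countable family; convergence in the graph of \<open>B\<close> also supplies the limit of
      \<open>snd (q n)\<close>.\<close>
    have N_B: "cinner (t x (\<i> *\<^sub>C b + b') + \<i> *\<^sub>C t x b) y = 0" if "x \<in> N" and bb': "(b, b') \<in> B" for x b b'
    proof -
      obtain p where p: "\<And>n. p n \<in> X" "p \<longlonglongrightarrow> x"
        using \<open>x \<in> N\<close> X(3) closure_sequential by blast
      obtain q where q: "\<And>n. q n \<in> Y" "q \<longlonglongrightarrow> (b, b')"
        using bb' Y(3) closure_sequential by blast
      have "(\<lambda>n. cinner (t (p n) (\<i> *\<^sub>C fst (q n) + snd (q n)) + \<i> *\<^sub>C t (p n) (fst (q n))) y)
          \<longlonglongrightarrow> cinner (t x (\<i> *\<^sub>C fst (b, b') + snd (b, b')) + \<i> *\<^sub>C t x (fst (b, b'))) y"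
        by (intro tendsto_cinner tendsto_add tendsto_scaleC tendsto_tensor[OF t complex_vector.subspace_UNIV]
            tendsto_fst tendsto_snd p q tendsto_const UNIV_I)
      moreover have "cinner (t (p n) (\<i> *\<^sub>C fst (q n) + snd (q n)) + \<i> *\<^sub>C t (p n) (fst (q n))) y = 0" for n
      proof -
        obtain k where "h k = p n" "g k = fst (q n)" "g' k = snd (q n)"
          using ex[of "p n" "fst (q n)" "snd (q n)"] p(1)[of n] q(1)[of n] by auto
        then show ?thesis
          using zero[of k] by (simp add: u_def)
      qed
      ultimately show ?thesis
        by (simp add: LIMSEQ_const_iff)
    qed
    \<comment> \<open>The shifted sums of \<open>A'\<close> split into those of \<open>A\<close>, to
      which \<open>y\<close> is orthogonal as a member of \<open>?M\<close>, and the vectors treated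
      in \<open>N_B\<close>.\<close>
    have "y \<in> ortho_complement (shifted_sums t \<i> A' B)"
      unfolding mem_ortho_complement_shifted_sums
    proof (intro allI impI)
      fix a a' b b' assume "(a, a') \<in> A'" and b: "(b, b') \<in> B"
      then obtain x x' k where *: "a = x + k" "a' = x' + \<i> *\<^sub>C k" "(x, x') \<in> A" "k \<in> N"
        by (auto simp: deficiency_extension_def)
      have "t a' b + t a b' + \<i> *\<^sub>C t a b
          = (t x' b + t x b' + \<i> *\<^sub>C t x b) + (t k (\<i> *\<^sub>C b + b') + \<i> *\<^sub>C t k b)"
        by (simp add: * t_simps scaleC_add_right)
      moreover have "cinner (t x' b + t x b' + \<i> *\<^sub>C t x b) y = 0"
        using \<open>y \<in> ?M\<close> *(3) b unfolding mem_ortho_complement_shifted_sums by blast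
      ultimately show "cinner (t a' b + t a b' + \<i> *\<^sub>C t a b) y = 0"
        using N_B[OF *(4) b] by (simp add: cinner_add_left)
    qed
    then show "y = 0"
      by (rule ortho_complement_extension)
  qed
  ultimately show ?thesis by simp
qed

end

section \<open>Exchanging the deficiency spaces by a change of sign\<close>

definition op_uminus :: "('a, 'b :: complex_hilbert_space) operator \<Rightarrow> ('a, 'b) operator" where
  "op_uminus A = {(x, y). (x, - y) \<in> A}"

lemma mem_op_uminus [simp]: "(x, y) \<in> op_uminus A \<longleftrightarrow> (x, - y) \<in> A"
  by (simp add: op_uminus_def)

lemma Domain_op_uminus: "Domain (op_uminus A) = Domain A"
  by (auto simp: Domain_iff) (metis minus_minus)

lemma op_uminus_eq_image: "op_uminus A = (\<lambda>z. (fst z, - snd z)) ` A"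
  by (auto simp: op_uminus_def image_iff) (metis fst_conv snd_conv minus_minus)

lemma linear_operator_op_uminus:
  assumes "linear_operator A"
  shows "linear_operator (op_uminus A)"
proof -
  have "csubspace (op_uminus A)"
    unfolding op_uminus_eq_image
    using assms by (intro csubspace_image) (auto simp: linear_operator_def scaleC_prod_def)
  then show ?thesis
    using assms by (auto simp: linear_operator_def single_valued_def) (metis neg_equal_iff_equal)
qed

lemma op_adjoint_op_uminus: "op_adjoint (op_uminus A) = op_uminus (op_adjoint A)"
proof -
  have "(y, z) \<in> op_adjoint (op_uminus A) \<longleftrightarrow> (y, - z) \<in> op_adjoint A" for y z
  proof
    assume *: "(y, z) \<in> op_adjoint (op_uminus A)"
    show "(y, - z) \<in> op_adjoint A"
    proof (rule op_adjointI)
      fix x w assume "(x, w) \<in> A"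
      then show "cinner w y = cinner x (- z)"
        using op_adjointD[OF *, of x "- w"] by (simp add: cinner_simps) (metis minus_minus)
    qed
  next
    assume *: "(y, - z) \<in> op_adjoint A"
    show "(y, z) \<in> op_adjoint (op_uminus A)"
    proof (rule op_adjointI)
      fix x w assume "(x, w) \<in> op_uminus A"
      then show "cinner w y = cinner x z"
        using op_adjointD[OF *, of x "- w"] by (simp add: cinner_simps)
    qed
  qed
  then show ?thesis
    by auto
qed

lemma symmetric_operator_op_uminus: "symmetric_operator A \<Longrightarrow> symmetric_operator (op_uminus A)"
  unfolding symmetric_operator_def densely_defined_def Domain_op_uminus op_adjoint_op_uminus
  by (auto simp: linear_operator_op_uminus)

lemma self_adjoint_operator_op_uminus: "self_adjoint_operator B \<Longrightarrow> self_adjoint_operator (op_uminus B)"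
  unfolding self_adjoint_operator_def densely_defined_def Domain_op_uminus op_adjoint_op_uminus
  by (auto simp: linear_operator_op_uminus)

text \<open>\<open>A - \<i>\<close> and \<open>- A + \<i>\<close> differ by a sign, so their ranges
  have the same orthogonal complement.\<close>

lemma deficiency_minus_eq: "deficiency_minus A = deficiency_plus (op_uminus A)"
proof -
  have "Range (op_add A (scalar_operator (- \<i>))) = uminus ` Range (op_add (op_uminus A) (scalar_operator \<i>))"
    by (simp add: Range_op_add_scalar op_uminus_eq_image image_image)
  moreover have "ortho_complement (uminus ` S) = ortho_complement S" for S :: "'a set"
    by (simp add: ortho_complement_def cinner_minus_left)
  ultimately show ?thesis
    by (simp add: deficiency_minus_def deficiency_plus_def)
qed

lemma (in tensor_self_adjoint) ortho_complement_shifted_sums_op_uminus: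
  "ortho_complement (shifted_sums t (- \<i>) A B) = ortho_complement (shifted_sums t \<i> (op_uminus A) (op_uminus B))"
proof -
  have minus: "t (- x) g = - t x g" "t x (- g) = - t x g" for x g
    using t_simps(3)[of "- 1" x g] t_simps(4)[of x "- 1" g] by (simp_all add: scaleC_minus_one)
  have eq: "cinner (t (- x') g + t x (- g') + \<i> *\<^sub>C t x g) y = - cinner (t x' g + t x g' + (- \<i>) *\<^sub>C t x g) y"
    for x x' g g' y
    by (simp add: minus cinner_simps)
  show ?thesis
  proof (rule set_eqI)
    fix y
    show "y \<in> ortho_complement (shifted_sums t (- \<i>) A B) \<longleftrightarrow>
        y \<in> ortho_complement (shifted_sums t \<i> (op_uminus A) (op_uminus B))"
      unfolding mem_ortho_complement_shifted_sums mem_op_uminus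
    proof (intro iffI allI impI)
      fix x x' g g'
      assume "\<forall>x x' g g'. (x, x') \<in> A \<longrightarrow> (g, g') \<in> B \<longrightarrow> cinner (t x' g + t x g' + (- \<i>) *\<^sub>C t x g) y = 0"
        and "(x, - x') \<in> A" "(g, - g') \<in> B"
      then show "cinner (t x' g + t x g' + \<i> *\<^sub>C t x g) y = 0"
        using eq[of "- x'" g x "- g'" y] by simp
    next
      fix x x' g g'
      assume "\<forall>x x' g g'. (x, - x') \<in> A \<longrightarrow> (g, - g') \<in> B \<longrightarrow> cinner (t x' g + t x g' + \<i> *\<^sub>C t x g) y = 0"
        and "(x, x') \<in> A" "(g, g') \<in> B"
      then have "cinner (t (- x') g + t x (- g') + \<i> *\<^sub>C t x g) y = 0"
        by simp
      then show "cinner (t x' g + t x g' + (- \<i>) *\<^sub>C t x g) y = 0"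
        unfolding eq by simp
    qed
  qed
qed

theorem theorem4p1:
  fixes H_A :: "('a :: complex_hilbert_space, 'a) operator"
    and H_B :: "('b :: complex_hilbert_space, 'b) operator"
    and tensor :: "'a \<Rightarrow> 'b \<Rightarrow> 'c :: complex_hilbert_space"
    and H_AB :: "('c, 'c) operator"
    and T_plus :: "'d :: complex_hilbert_space set"
    and tensor_plus :: "'a \<Rightarrow> 'b \<Rightarrow> 'd"
    and T_minus :: "'e :: complex_hilbert_space set"
    and tensor_minus :: "'a \<Rightarrow> 'b \<Rightarrow> 'e"
  assumes "separable_space (euclidean :: 'a topology)"
    and "separable_space (euclidean :: 'b topology)"
    and "symmetric_operator H_A"
    and "self_adjoint_operator H_B"
    and "is_hilbert_tensor UNIV UNIV UNIV tensor"
    and "H_AB = closure (op_add (op_hilbert_tensor tensor H_A Id) (op_hilbert_tensor tensor Id H_B))"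
    and "is_hilbert_tensor (deficiency_plus H_A) UNIV T_plus tensor_plus"
    and "is_hilbert_tensor (deficiency_minus H_A) UNIV T_minus tensor_minus"
  shows "isometrically_isomorphic (deficiency_plus H_AB) T_plus \<and>
         isometrically_isomorphic (deficiency_minus H_AB) T_minus"
proof -
  note sep = assms(1,2) and A = assms(3) and B = assms(4) and t = assms(5) and H_AB = assms(6)
  have plus: "deficiency_plus H_AB = ortho_complement (shifted_sums tensor \<i> H_A H_B)"
    and minus: "deficiency_minus H_AB = ortho_complement (shifted_sums tensor \<i> (op_uminus H_A) (op_uminus H_B))"
  proof -
    interpret tensor_self_adjoint tensor H_B
      by unfold_locales fact+
    show "deficiency_plus H_AB = ortho_complement (shifted_sums tensor \<i> H_A H_B)"
      unfolding deficiency_plus_def H_AB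
      by (rule ortho_complement_Range_closure[OF symmetric_operatorD(2)[OF A]])
    show "deficiency_minus H_AB = ortho_complement (shifted_sums tensor \<i> (op_uminus H_A) (op_uminus H_B))"
      unfolding deficiency_minus_def H_AB ortho_complement_Range_closure[OF symmetric_operatorD(2)[OF A]]
      by (rule ortho_complement_shifted_sums_op_uminus)
  qed
  interpret plus: tensor_symmetric_self_adjoint tensor H_B H_A
    by unfold_locales fact+
  \<comment> \<open>The minus case is the plus case for the negated operators, as the plus space of
    \<open>op_uminus H_A\<close> is \<open>deficiency_minus H_A\<close>.\<close>
  interpret minus: tensor_symmetric_self_adjoint tensor "op_uminus H_B" "op_uminus H_A"
    by unfold_locales (fact t self_adjoint_operator_op_uminus[OF B] symmetric_operator_op_uminus[OF A])+
  show ?thesis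
    using plus.isometrically_isomorphic_deficiency[OF sep assms(7)]
      minus.isometrically_isomorphic_deficiency[OF sep assms(8)[unfolded deficiency_minus_eq]]
    by (simp add: plus minus)
qed

end
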